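(* Let $R(q)=\dfrac{(q;q^5)_\infty(q^4;q^5)_\infty}{(q^2;q^5)_\infty(q^3;q^5)_\infty}$ and define integers $B(n)$ by $R^5(q)=\sum_{n=0}^{\infty}B(n)q^{n}$. Then for all nonnegative integers $n$, $$B(5n+1)<0,\quad B(5n+2)>0,\quad B(5n+3)<0,\quad B(5n+4)>0.$$
   Context: For complex $a,q$ with $|q|<1$, $(a;q)_\infty:=\prod_{k=0}^{\infty}(1-aq^k)$. All series are power series in $q$. *)

theory Defs
  imports "HOL-Analysis.Analysis"
begin

text \<open>Only meaningful for \<open>norm q < 1\<close>, where the product converges (in the sense of
  \<^const>\<open>has_prod\<close>, which also covers products with finitely many vanishing factors).\<close>

definition qpochhammer_inf :: "complex \<Rightarrow> complex \<Rightarrow> complex" where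
  "qpochhammer_inf a q = (\<Prod>k. 1 - a * q ^ k)"

definition rogers_ramanujan_R :: "complex \<Rightarrow> complex" where
  "rogers_ramanujan_R q =
     (qpochhammer_inf q (q ^ 5) * qpochhammer_inf (q ^ 4) (q ^ 5)) /
     (qpochhammer_inf (q ^ 2) (q ^ 5) * qpochhammer_inf (q ^ 3) (q ^ 5))"

end

theory Submission
  imports Defs
begin

text \<open>
  Write \<open>R = A / C\<close> with \<open>A = (q, q\<^sup>4; q\<^sup>5)\<^sub>\<infinity>\<close> and \<open>C = (q\<^sup>2, q\<^sup>3; q\<^sup>5)\<^sub>\<infinity>\<close>, let
  \<open>E(q) = (q; q)\<^sub>\<infinity>\<close>, and put \<open>v = q R(q\<^sup>5)\<close>.
  The Jacobi triple product and the quintuple product give the 5-dissection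
  \<open>E(q) = E(q\<^bsup>25\<^esup>) (1 / R(q\<^sup>5) - q - q\<^sup>2 R(q\<^sup>5))\<close>. Multiplying it over \<open>q \<mapsto> \<omega>\<^sup>j q\<close> for a fifth
  root of unity \<open>\<omega>\<close> yields \<open>E(q)\<^sup>6 / E(q\<^sup>5)\<^sup>6 = 1 / R\<^sup>5 - 11 q - q\<^sup>2 R\<^sup>5\<close>. Comparing the two, \<open>U = q R\<^sup>5\<close>
  satisfies a quadratic equation over \<open>\<rat>(v)\<close>, and its root that vanishes at \<open>q = 0\<close> is
  \<open>U = v P(v) / Q(v)\<close>, Ramanujan's modular equation. Since \<open>P Q (1 - v - v\<^sup>2) = 1 - 11 v\<^sup>5 - v\<^bsup>10\<^esup>\<close> is a
  power series in \<open>q\<^sup>5\<close>, expanding \<open>P\<^sup>2 (1 - v - v\<^sup>2)\<close> gives the 5-dissection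
  \<open>R\<^sup>5 = \<Sum>\<^sub>i c\<^sub>i q\<^sup>i G(q\<^sup>5)\<^bsup>10-i\<^esup> H(q\<^sup>5)\<^bsup>2+i\<^esup>\<close> with \<open>G = 1 / A\<close>, \<open>H = 1 / C\<close>.

  In the residue classes 2, 3 and 4 modulo 5 both contributing \<open>c\<^sub>i\<close> have the same sign, and \<open>G\<close>, \<open>H\<close>
  have nonnegative coefficients. The class 1 contributes \<open>-5 G\<^sup>4 H\<^sup>3 (G\<^sup>5 - 3 q H\<^sup>5)\<close>, so there it remains to
  see that \<open>G\<^sup>5 - 3 q H\<^sup>5\<close> has nonnegative coefficients; this follows by replacing, one at a time, the
  factors \<open>1 / ((1 - q\<^bsup>5k+1\<^esup>) (1 - q\<^bsup>5k+4\<^esup>))\<close> of \<open>G\<^sup>5\<close> with \<open>k \<ge> 1\<close> by the factors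
  \<open>1 / ((1 - q\<^bsup>5k+2\<^esup>) (1 - q\<^bsup>5k+3\<^esup>))\<close> of \<open>H\<^sup>5\<close>.
\<close>

section \<open>Infinite q-Pochhammer symbols\<close>

lemma qpochhammer_inf_convergent:
  fixes a q :: complex
  assumes "norm q < 1"
  shows "convergent_prod (\<lambda>k. 1 - a * q ^ k)"
proof -
  have "summable (\<lambda>k. norm (1 - a * q ^ k - 1))"
    using assms by (simp add: norm_mult norm_power summable_mult summable_geometric)
  thus ?thesis
    by (intro abs_convergent_prod_imp_convergent_prod summable_imp_abs_convergent_prod)
qed

lemma qpochhammer_inf_LIMSEQ:
  assumes "norm q < 1"
  shows "(\<lambda>n. \<Prod>k<n. 1 - a * q ^ k) \<longlonglongrightarrow> qpochhammer_inf a q"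
proof -
  have "(\<lambda>n. \<Prod>k\<le>n. 1 - a * q ^ k) \<longlonglongrightarrow> qpochhammer_inf a q"
    unfolding qpochhammer_inf_def
    by (rule convergent_prod_LIMSEQ[OF qpochhammer_inf_convergent[OF assms]])
  thus ?thesis
    by (subst filterlim_sequentially_Suc [symmetric]) (simp add: lessThan_Suc_atMost)
qed

lemma qpochhammer_inf_nonzero:
  assumes "norm q < 1" "norm a < 1"
  shows "qpochhammer_inf a q \<noteq> 0"
proof -
  have "1 - a * q ^ k \<noteq> 0" for k
  proof
    assume "1 - a * q ^ k = 0"
    hence "norm (a * q ^ k) = 1" by simp
    moreover have "norm (a * q ^ k) \<le> norm a * 1"
      unfolding norm_mult norm_power using assms by (intro mult_left_mono power_le_one) auto
    ultimately show False using assms by simp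
  qed
  thus ?thesis
    unfolding qpochhammer_inf_def
    using prodinf_nonzero[OF qpochhammer_inf_convergent[OF assms(1), of a]] by blast
qed

lemma qpochhammer_inf_rec:
  assumes "norm q < 1"
  shows "qpochhammer_inf a q = (1 - a) * qpochhammer_inf (a * q) q"
proof -
  have "(\<lambda>n. (1 - a) * (\<Prod>k<n. 1 - (a * q) * q ^ k)) \<longlonglongrightarrow> (1 - a) * qpochhammer_inf (a * q) q"
    by (intro tendsto_intros qpochhammer_inf_LIMSEQ assms)
  moreover have "(1 - a) * (\<Prod>k<n. 1 - (a * q) * q ^ k) = (\<Prod>k<Suc n. 1 - a * q ^ k)" for n
    by (subst prod.lessThan_Suc_shift) (simp add: mult.assoc)
  ultimately have "(\<lambda>n. \<Prod>k<Suc n. 1 - a * q ^ k) \<longlonglongrightarrow> (1 - a) * qpochhammer_inf (a * q) q"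
    by simp
  moreover have "(\<lambda>n. \<Prod>k<Suc n. 1 - a * q ^ k) \<longlonglongrightarrow> qpochhammer_inf a q"
    using qpochhammer_inf_LIMSEQ[OF assms, of a] by (subst filterlim_sequentially_Suc)
  ultimately show ?thesis by (rule LIMSEQ_unique[symmetric])
qed

text \<open>Sorting the first \<open>m * n\<close> factors by the residue of the exponent modulo
  \<open>m\<close> gives \<open>m\<close> partial products of length \<open>n\<close>; the claim is
  the limit along this subsequence.\<close>

lemma qpochhammer_inf_split:
  assumes "norm q < 1" "m > 0"
  shows "qpochhammer_inf a q = (\<Prod>i<m. qpochhammer_inf (a * q ^ i) (q ^ m))"
proof -
  have qm: "norm (q ^ m) < 1"
    using assms by (simp add: norm_power power_Suc_less_one power_less_one_iff)
  have fin: "(\<Prod>k<m * n. 1 - a * q ^ k) = (\<Prod>i<m. \<Prod>k<n. 1 - a * q ^ i * (q ^ m) ^ k)" for n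
  proof (induction n)
    case (Suc n)
    have "(\<Prod>k<m * Suc n. 1 - a * q ^ k)
        = (\<Prod>k<m * n. 1 - a * q ^ k) * (\<Prod>k\<in>{m*n..<m*n+m}. 1 - a * q ^ k)"
      by (subst prod.union_disjoint[symmetric]) (auto intro!: prod.cong)
    also have "(\<Prod>k\<in>{m*n..<m*n+m}. 1 - a * q ^ k) = (\<Prod>i<m. 1 - a * q ^ (i + m * n))"
      by (rule prod.reindex_bij_witness[of _ "\<lambda>i. i + m * n" "\<lambda>i. i - m * n"]) auto
    finally show ?case
      by (simp add: Suc prod.distrib power_add power_mult mult_ac)
  qed simp
  have "(\<lambda>n. \<Prod>k<m * n. 1 - a * q ^ k) \<longlonglongrightarrow> qpochhammer_inf a q"
    by (rule filterlim_compose[OF qpochhammer_inf_LIMSEQ[OF assms(1)]])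
       (use assms in \<open>intro mult_nat_left_at_top\<close>)
  moreover have "(\<lambda>n. \<Prod>k<m * n. 1 - a * q ^ k) \<longlonglongrightarrow> (\<Prod>i<m. qpochhammer_inf (a * q ^ i) (q ^ m))"
    unfolding fin by (intro tendsto_prod qpochhammer_inf_LIMSEQ qm)
  ultimately show ?thesis by (rule LIMSEQ_unique)
qed

lemma qpochhammer_inf_mult_minus:
  assumes "norm q < 1"
  shows "qpochhammer_inf a q * qpochhammer_inf (- a) q = qpochhammer_inf (a\<^sup>2) (q\<^sup>2)"
proof -
  have q2: "norm (q\<^sup>2) < 1"
    using assms by (simp add: norm_power power_less_one_iff)
  have "(\<lambda>n. (\<Prod>k<n. 1 - a * q ^ k) * (\<Prod>k<n. 1 - (-a) * q ^ k))
          \<longlonglongrightarrow> qpochhammer_inf a q * qpochhammer_inf (- a) q"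
    by (intro tendsto_intros qpochhammer_inf_LIMSEQ assms)
  moreover have "(\<Prod>k<n. 1 - a * q ^ k) * (\<Prod>k<n. 1 - (-a) * q ^ k) = (\<Prod>k<n. 1 - a\<^sup>2 * (q\<^sup>2) ^ k)" for n
    unfolding prod.distrib[symmetric]
    by (intro prod.cong) (auto simp: algebra_simps power2_eq_square power_mult_distrib)
  ultimately show ?thesis
    using qpochhammer_inf_LIMSEQ[OF q2, of "a\<^sup>2"] LIMSEQ_unique by force
qed

section \<open>The Jacobi triple product\<close>

primrec qbinomial :: "complex \<Rightarrow> nat \<Rightarrow> nat \<Rightarrow> complex" where
  "qbinomial q 0 k = (if k = 0 then 1 else 0)"
| "qbinomial q (Suc n) k =
     (case k of 0 \<Rightarrow> 1 | Suc j \<Rightarrow> qbinomial q n k + q ^ (n - j) * qbinomial q n j)"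

lemma qbinomial_0_right [simp]: "qbinomial q n 0 = 1"
  by (cases n) auto

lemma qbinomial_eq_0: "k > n \<Longrightarrow> qbinomial q n k = 0"
  by (induction n arbitrary: k) (auto split: nat.splits)

text \<open>The q-factorial without its usual denominator \<open>(1 - q) ^ n\<close>.\<close>

definition qfact :: "complex \<Rightarrow> nat \<Rightarrow> complex" where
  "qfact q n = (\<Prod>k<n. 1 - q * q ^ k)"

lemma qfact_Suc: "qfact q (Suc n) = qfact q n * (1 - q ^ Suc n)"
  by (simp add: qfact_def)

text \<open>Kept free of division. In the induction the two terms of the q-Pascal recurrence
  contribute \<open>1 - q ^ (n - j)\<close> and \<open>q ^ (n - j) * (1 - q ^ Suc j)\<close> times
  \<open>qfact q n\<close>, which add up to \<open>1 - q ^ Suc n\<close> times it.\<close>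

lemma qbinomial_qfact:
  "k \<le> n \<Longrightarrow> qbinomial q n k * qfact q k * qfact q (n - k) = qfact q n"
proof (induction n arbitrary: k)
  case 0
  thus ?case by (simp add: qfact_def)
next
  case (Suc n)
  show ?case
  proof (cases k)
    case 0
    thus ?thesis by (simp add: qfact_def)
  next
    case (Suc j)
    with Suc.prems have j: "j \<le> n" by simp
    have 1: "qbinomial q n j * qfact q j * qfact q (n - j) = qfact q n"
      by (rule Suc.IH[OF j])
    have 2: "qbinomial q n (Suc j) * qfact q (Suc j) * qfact q (n - j) = qfact q n * (1 - q ^ (n - j))"
    proof (cases "j = n")
      case True
      thus ?thesis by (simp add: qbinomial_eq_0)
    next
      case False
      with j have nj: "n - j = Suc (n - Suc j)" "Suc j \<le> n" by auto
      show ?thesis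
        using Suc.IH[OF nj(2)] by (simp only: nj(1) qfact_Suc) (simp add: mult_ac)
    qed
    have pw: "q ^ (n - j) * q ^ Suc j = q ^ Suc n"
      using j by (simp flip: power_add power_Suc)
    have "qbinomial q (Suc n) k * qfact q k * qfact q (Suc n - k)
        = qbinomial q n (Suc j) * qfact q (Suc j) * qfact q (n - j)
          + q ^ (n - j) * (1 - q ^ Suc j) * (qbinomial q n j * qfact q j * qfact q (n - j))"
      unfolding Suc by (simp add: qfact_Suc algebra_simps)
    also have "\<dots> = qfact q n * (1 - q ^ (n - j) * q ^ Suc j)"
      unfolding 1 2 by (simp add: algebra_simps)
    also have "\<dots> = qfact q (Suc n)"
      unfolding pw by (simp add: qfact_Suc)
    finally show ?thesis .
  qed
qed

lemma half_pronic_Suc: "Suc k * (Suc k - 1) div 2 = k + k * (k - 1) div 2"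
proof -
  have "even (k * (k - 1))" by auto
  then obtain c where "k * (k - 1) = 2 * c" by (elim evenE)
  moreover have "Suc k * (Suc k - 1) = 2 * k + k * (k - 1)"
    by (cases k) (auto simp: algebra_simps)
  ultimately show ?thesis by simp
qed

text \<open>By the q-Pascal recurrence the sum for \<open>Suc n\<close> is the sum for
  \<open>n\<close> plus an index-shifted copy of it, and the shift multiplies the copy by exactly
  \<open>- x * q ^ n\<close>.\<close>

lemma qbinomial_theorem:
  "(\<Prod>k<n. 1 - x * q ^ k) = (\<Sum>k\<le>n. (-x) ^ k * q ^ (k * (k - 1) div 2) * qbinomial q n k)"
proof (induction n)
  case (Suc n)
  define t where "t k = (-x) ^ k * q ^ (k * (k - 1) div 2)" for k
  have t_Suc: "t (Suc k) = - x * q ^ k * t k" for k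
    unfolding t_def half_pronic_Suc by (simp add: power_add)
  have "(\<Sum>k\<le>Suc n. t k * qbinomial q (Suc n) k)
      = t 0 * qbinomial q n 0 + (\<Sum>k\<le>n. t (Suc k) * qbinomial q n (Suc k))
        + (\<Sum>k\<le>n. t (Suc k) * q ^ (n - k) * qbinomial q n k)"
    by (subst sum.atMost_Suc_shift) (simp add: algebra_simps sum.distrib)
  also have "t 0 * qbinomial q n 0 + (\<Sum>k\<le>n. t (Suc k) * qbinomial q n (Suc k))
      = (\<Sum>k\<le>Suc n. t k * qbinomial q n k)"
    by (subst sum.atMost_Suc_shift) simp
  also have "\<dots> = (\<Sum>k\<le>n. t k * qbinomial q n k)"
    by (simp add: qbinomial_eq_0)
  also have "(\<Sum>k\<le>n. t (Suc k) * q ^ (n - k) * qbinomial q n k)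
      = (\<Sum>k\<le>n. - x * q ^ n * (t k * qbinomial q n k))"
  proof (intro sum.cong refl)
    fix k assume "k \<in> {..n}"
    hence "q ^ k * q ^ (n - k) = q ^ n" by (simp flip: power_add)
    thus "t (Suc k) * q ^ (n - k) * qbinomial q n k = - x * q ^ n * (t k * qbinomial q n k)"
      unfolding t_Suc by (simp add: mult_ac)
  qed
  also have "\<dots> = - x * q ^ n * (\<Sum>k\<le>n. t k * qbinomial q n k)"
    by (simp add: sum_distrib_left)
  finally have "(\<Sum>k\<le>Suc n. t k * qbinomial q (Suc n) k) = (1 - x * q ^ n) * (\<Sum>k\<le>n. t k * qbinomial q n k)"
    by (simp add: algebra_simps)
  thus ?case
    using Suc by (simp add: t_def mult.commute)
qed simp

text \<open>General term of the bilateral theta series; the division by 2 is exact.\<close>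

definition theta_term :: "complex \<Rightarrow> complex \<Rightarrow> int \<Rightarrow> complex" where
  "theta_term z q n = (-z) powi n * q powi (n * (n - 1) div 2)"

lemma half_pronic_double: "2 * (n * (n - 1) div 2) = n * (n - 1)" for n :: int
proof -
  have "even (n * (n - 1))" by auto
  thus ?thesis by simp
qed

lemma half_pronic_of_nat: "int n * (int n - 1) div 2 = int (n * (n - 1) div 2)"
proof -
  have "int n * (int n - 1) = int (n * (n - 1))"
    by (cases n) (auto simp: algebra_simps)
  thus ?thesis by (simp only: of_nat_div of_nat_numeral)
qed

text \<open>The q-binomial theorem with \<open>2 * N\<close> factors at
  \<open>x = z * q powi (- int N)\<close>. The upper half of the factors is the first product; the
  lower half becomes the second once a monomial is pulled out of each factor.\<close>

lemma finite_triple_product: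
  assumes "q \<noteq> 0" "z \<noteq> 0"
  shows "(\<Prod>k<N. 1 - z * q ^ k) * (\<Prod>k<N. 1 - (q / z) * q ^ k)
       = (\<Sum>j=-int N..int N. qbinomial q (2 * N) (nat (int N + j)) * theta_term z q j)"
proof -
  define x where "x = z * q powi (- int N)"
  \<comment> \<open>Collects the monomials pulled out in 1 - z/q^(k+1) = -(z/q^(k+1)) (1 -
    q^(k+1)/z).\<close>
  define K where "K N = (\<Prod>k<N. - z * q powi (- int (Suc k)))" for N
  have K0: "K N \<noteq> 0" using assms by (simp add: K_def)
  have K_eq: "K N = (-z) ^ N * q powi (- (int N * (int N + 1) div 2))" for N
  proof (induction N)
    case (Suc N)
    have "- (int (Suc N) * (int (Suc N) + 1) div 2) = - (int N * (int N + 1) div 2) + (- int (Suc N))"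
      using half_pronic_double[of "int N + 1"] half_pronic_double[of "int N + 2"] by (simp add: algebra_simps)
    thus ?case
      using Suc assms by (simp add: K_def power_int_diff power_int_minus divide_inverse del: of_nat_Suc)
  qed (simp add: K_def)
  have "(\<Prod>k<2*N. 1 - x * q ^ k) = (\<Prod>k<N. 1 - x * q ^ k) * (\<Prod>k=N..<2*N. 1 - x * q ^ k)"
    by (subst prod.union_disjoint[symmetric]) (auto intro!: prod.cong)
  also have "(\<Prod>k=N..<2*N. 1 - x * q ^ k) = (\<Prod>k<N. 1 - z * q ^ k)"
    by (rule prod.reindex_bij_witness[of _ "\<lambda>i. i + N" "\<lambda>i. i - N"])
       (use assms in \<open>auto simp: x_def power_int_minus power_add field_simps power_diff\<close>)
  also have "(\<Prod>k<N. 1 - x * q ^ k) = (\<Prod>k<N. 1 - x * q ^ (N - Suc k))"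
    by (rule prod.nat_diff_reindex[symmetric])
  also have "\<dots> = (\<Prod>k<N. (- z * q powi (- int (Suc k))) * (1 - (q / z) * q ^ k))"
  proof (intro prod.cong refl)
    fix k assume "k \<in> {..<N}"
    hence "q ^ N = q ^ (N - Suc k) * (q * q ^ k)" by (simp flip: power_add power_Suc)
    thus "1 - x * q ^ (N - Suc k) = (- z * q powi (- int (Suc k))) * (1 - (q / z) * q ^ k)"
      using assms unfolding x_def power_int_minus power_int_of_nat by (simp add: field_simps)
  qed
  also have "\<dots> = K N * (\<Prod>k<N. 1 - (q / z) * q ^ k)"
    unfolding K_def prod.distrib ..
  finally have 1: "(\<Prod>k<2*N. 1 - x * q ^ k)
      = K N * ((\<Prod>k<N. 1 - z * q ^ k) * (\<Prod>k<N. 1 - (q / z) * q ^ k))"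
    by (simp add: mult_ac)
  have "(\<Prod>k<2*N. 1 - x * q ^ k) = (\<Sum>k\<le>2*N. (-x) ^ k * q ^ (k * (k - 1) div 2) * qbinomial q (2*N) k)"
    by (rule qbinomial_theorem)
  also have "\<dots> = (\<Sum>j=-int N..int N. K N * (qbinomial q (2 * N) (nat (int N + j)) * theta_term z q j))"
  proof (rule sum.reindex_bij_witness[of _ "\<lambda>j. nat (int N + j)" "\<lambda>k. int k - int N"])
    fix k assume "k \<in> {..2*N}"
    have padd: "q powi a * q powi b = q powi (a + b)" for a b
      using assms by (simp add: power_int_add)
    have N: "2 * (int N * (int N + 1) div 2) = int N * (int N + 1)"
      using half_pronic_double[of "int N + 1"] by (simp add: mult.commute)
    \<comment> \<open>The exponents of \<open>q\<close> are compared after doubling, which removes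
      the divisions by 2.\<close>
    have "2 * (- int N * int k + int (k * (k - 1) div 2))
        = 2 * (- (int N * (int N + 1) div 2) + (int k - int N) * (int k - int N - 1) div 2)"
      unfolding distrib_left half_pronic_of_nat[symmetric] half_pronic_double mult_minus_right N
      by (simp add: algebra_simps)
    hence "- int N * int k + int (k * (k - 1) div 2)
        = - (int N * (int N + 1) div 2) + (int k - int N) * (int k - int N - 1) div 2"
      by (simp only: mult_cancel_left) simp
    hence "q powi (- int N * int k) * q powi (int (k * (k - 1) div 2))
        = q powi (- (int N * (int N + 1) div 2)) * q powi ((int k - int N) * (int k - int N - 1) div 2)"
      by (simp only: padd)
    moreover have "(-x) ^ k = (-z) ^ k * q powi (- int N * int k)"
      by (simp only: x_def power_int_mult power_int_of_nat power_mult_distrib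
            flip: mult_minus_left)
    moreover have "(-z) ^ k = (-z) ^ N * (-z) powi (int k - int N)"
      using assms by (simp add: power_int_diff)
    ultimately have "(-x) ^ k * q ^ (k * (k - 1) div 2) = K N * theta_term z q (int k - int N)"
      unfolding K_eq theta_term_def power_int_of_nat by (simp add: mult_ac)
    thus "K N * (qbinomial q (2 * N) (nat (int N + (int k - int N))) * theta_term z q (int k - int N))
        = (-x) ^ k * q ^ (k * (k - 1) div 2) * qbinomial q (2*N) k"
      by simp
  qed auto
  also have "\<dots> = K N * (\<Sum>j=-int N..int N. qbinomial q (2 * N) (nat (int N + j)) * theta_term z q j)"
    by (simp add: sum_distrib_left)
  finally show ?thesis unfolding 1 using K0 by simp
qed

text \<open>The ratio of consecutive terms is \<open>w * r ^ n\<close>, which tends to 0.\<close>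

lemma summable_power_triangle:
  fixes w r :: real
  assumes "0 \<le> w" "0 \<le> r" "r < 1"
  shows "summable (\<lambda>n. w ^ n * r ^ (n * (n - 1) div 2))"
proof -
  have "(\<lambda>n. w * r ^ n) \<longlonglongrightarrow> w * 0"
    by (intro tendsto_intros LIMSEQ_power_zero) (use assms in auto)
  hence "eventually (\<lambda>n. w * r ^ n < 1/2) sequentially"
    by (intro order_tendstoD(2)[of _ "w * 0"]) auto
  then obtain N where N: "\<And>n. n \<ge> N \<Longrightarrow> w * r ^ n < 1/2"
    unfolding eventually_at_top_linorder by blast
  show ?thesis
  proof (rule summable_ratio_test[of "1/2" N])
    fix n assume "n \<ge> N"
    have "norm (w ^ Suc n * r ^ (Suc n * (Suc n - 1) div 2)) = (w * r ^ n) * norm (w ^ n * r ^ (n * (n - 1) div 2))"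
      unfolding half_pronic_Suc using assms by (simp add: power_add abs_mult mult_ac)
    also have "\<dots> \<le> 1/2 * norm (w ^ n * r ^ (n * (n - 1) div 2))"
      using N[OF \<open>n \<ge> N\<close>] by (intro mult_right_mono) auto
    finally show "norm (w ^ Suc n * r ^ (Suc n * (Suc n - 1) div 2)) \<le> 1/2 * norm (w ^ n * r ^ (n * (n - 1) div 2))" .
  qed simp
qed

text \<open>Replacing \<open>n\<close> by \<open>- n\<close> amounts to replacing \<open>z\<close>
  by \<open>q / z\<close>, so both halves of the integers reduce to the same kind of triangular
  series.\<close>

lemma abs_summable_theta_term:
  assumes "q \<noteq> 0" "norm q < 1" "z \<noteq> 0"
  shows "(\<lambda>n. norm (theta_term z q n)) summable_on UNIV"
proof -
  have pos: "norm (theta_term z q (int n)) = norm z ^ n * norm q ^ (n * (n - 1) div 2)" for n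
    unfolding theta_term_def half_pronic_of_nat power_int_of_nat by (simp add: norm_mult norm_power)
  have neg: "norm (theta_term z q (- int n)) = norm (q / z) ^ n * norm q ^ (n * (n - 1) div 2)" for n
  proof -
    have "- int n * (- int n - 1) div 2 = int n + int (n * (n - 1) div 2)"
      using half_pronic_double[of "- int n"] half_pronic_double[of "int n"]
      unfolding half_pronic_of_nat[symmetric] by (simp add: algebra_simps)
    thus ?thesis using assms
      by (simp add: theta_term_def norm_mult norm_power power_int_add power_int_minus norm_inverse
           norm_divide field_simps del: of_nat_div)
  qed
  have "(\<lambda>n. norm (theta_term z q n)) summable_on (int ` UNIV)"
    unfolding summable_on_reindex[OF inj_of_nat] o_def pos
    by (rule norm_summable_imp_summable_on) (use assms summable_power_triangle in auto)
  moreover have "(\<lambda>n. norm (theta_term z q n)) summable_on ((\<lambda>n. - int n) ` UNIV)"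
    unfolding summable_on_reindex[OF inj_onI[of UNIV "\<lambda>n. - int n", simplified]] o_def neg
    by (rule norm_summable_imp_summable_on) (use assms summable_power_triangle in auto)
  ultimately have "(\<lambda>n. norm (theta_term z q n)) summable_on (int ` UNIV \<union> (\<lambda>n. - int n) ` UNIV)"
    by (rule summable_on_union)
  moreover have "int ` UNIV \<union> (\<lambda>n. - int n) ` UNIV = UNIV"
  proof -
    have "x \<in> int ` UNIV \<union> (\<lambda>n. - int n) ` UNIV" for x
      by (cases x rule: int_cases2) auto
    thus ?thesis by blast
  qed
  ultimately show ?thesis by simp
qed

definition theta :: "complex \<Rightarrow> complex \<Rightarrow> complex" where
  "theta z q = qpochhammer_inf z q * qpochhammer_inf (q / z) q * qpochhammer_inf q q"

text \<open>The limit of \<open>finite_triple_product\<close> as \<open>N\<close> grows: each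
  Gaussian binomial tends to \<open>1 / ?E\<close>, and Tannery's theorem exchanges limit and sum,
  because the Gaussian binomials are bounded uniformly in \<open>N\<close> and
  \<open>j\<close>.\<close>

theorem jacobi_triple_product:
  assumes "q \<noteq> 0" "norm q < 1" "z \<noteq> 0"
  shows "(theta_term z q has_sum theta z q) UNIV"
proof -
  let ?E = "qpochhammer_inf q q"
  \<comment> \<open>Extending by 0 outside the range makes every finite sum a sum over all
    integers.\<close>
  define c where "c N j = (if j \<in> {-int N..int N} then qbinomial q (2 * N) (nat (int N + j)) else 0)" for N j
  have lim: "qfact q \<longlonglongrightarrow> ?E"
    using qpochhammer_inf_LIMSEQ[OF assms(2), of q] by (simp add: qfact_def [abs_def])
  have E0: "?E \<noteq> 0" by (rule qpochhammer_inf_nonzero) (use assms in auto)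
  have nz: "qfact q n \<noteq> 0" for n
  proof
    assume "qfact q n = 0"
    then obtain k where "q * q ^ k = 1" by (auto simp: qfact_def)
    hence "norm (q * q ^ k) = 1" by simp
    hence "norm q ^ Suc k = 1" by (simp add: norm_mult norm_power)
    moreover have "norm q ^ Suc k < 1"
      using assms by (intro power_Suc_less_one) auto
    ultimately show False by linarith
  qed
  have c_eq: "c N j = qfact q (2 * N) / (qfact q (nat (int N + j)) * qfact q (nat (int N - j)))"
    if "j \<in> {-int N..int N}" for N j
  proof -
    have "2 * N - nat (int N + j) = nat (int N - j)" "nat (int N + j) \<le> 2 * N" using that by auto
    thus ?thesis
      using qbinomial_qfact[of "nat (int N + j)" "2 * N" q] that nz by (simp add: c_def field_simps)
  qed
  have c_lim: "(\<lambda>N. c N j) \<longlonglongrightarrow> 1 / ?E" for j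
  proof -
    have f1: "filterlim (\<lambda>N. nat (int N + j)) at_top sequentially"
      unfolding filterlim_at_top
    proof
      fix Z :: nat
      show "\<forall>\<^sub>F x in sequentially. Z \<le> nat (int x + j)"
        using eventually_ge_at_top[of "Z + nat \<bar>j\<bar>"] by eventually_elim linarith
    qed
    have f2: "filterlim (\<lambda>N. nat (int N - j)) at_top sequentially"
      unfolding filterlim_at_top
    proof
      fix Z :: nat
      show "\<forall>\<^sub>F x in sequentially. Z \<le> nat (int x - j)"
        using eventually_ge_at_top[of "Z + nat \<bar>j\<bar>"] by eventually_elim linarith
    qed
    have f3: "filterlim (\<lambda>N::nat. 2 * N) at_top sequentially" by (intro mult_nat_left_at_top) auto
    have "(\<lambda>N. qfact q (2 * N) / (qfact q (nat (int N + j)) * qfact q (nat (int N - j)))) \<longlonglongrightarrow> ?E / (?E * ?E)"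
      by (intro tendsto_intros filterlim_compose[OF lim f1] filterlim_compose[OF lim f2] filterlim_compose[OF lim f3])
         (use E0 in auto)
    moreover have "\<forall>\<^sub>F N in sequentially.
        qfact q (2 * N) / (qfact q (nat (int N + j)) * qfact q (nat (int N - j))) = c N j"
      using eventually_ge_at_top[of "nat \<bar>j\<bar>"] by eventually_elim (subst c_eq, auto)
    ultimately show ?thesis using E0 by (force intro: Lim_transform_eventually)
  qed
  have "Bseq (qfact q)" using lim convergent_imp_Bseq convergent_def by blast
  then obtain K1 where K1: "K1 > 0" "\<And>n. norm (qfact q n) \<le> K1" by (auto simp: Bseq_def)
  have "Bseq (\<lambda>n. inverse (qfact q n))" 
    using tendsto_inverse[OF lim E0] convergent_imp_Bseq convergent_def by blast
  then obtain K2 where K2: "K2 > 0" "\<And>n. norm (inverse (qfact q n)) \<le> K2" by (auto simp: Bseq_def)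
  have c_bound: "norm (c N j) \<le> K1 * (K2 * K2)" for N j
  proof (cases "j \<in> {-int N..int N}")
    case True
    show ?thesis unfolding c_eq[OF True] divide_inverse inverse_mult_distrib norm_mult
      by (intro mult_mono K1 K2) (use K1 K2 in auto)
  next
    case False
    thus ?thesis unfolding c_def using K1 K2 by auto
  qed
  \<comment> \<open>An enumeration of the integers, so that Tannery's theorem is applied to ordinary
    series.\<close>
  define d where "d = int_decode"
  have d: "bij_betw d UNIV UNIV" unfolding d_def by (simp add: bij_int_decode)
  have sm: "summable (\<lambda>i. norm (theta_term z q (d i)))"
  proof -
    have "(\<lambda>i. norm (theta_term z q (d i))) summable_on UNIV"
      using summable_on_reindex_bij_betw[OF d, of "\<lambda>n. norm (theta_term z q n)"]
        abs_summable_theta_term[OF assms] by simp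
    thus ?thesis by (rule summable_on_imp_summable)
  qed
  have "(\<lambda>N. \<Sum>i. c N (d i) * theta_term z q (d i)) \<longlonglongrightarrow> (\<Sum>i. 1 / ?E * theta_term z q (d i))"
  proof (rule tannerys_theorem[THEN conjunct2, THEN conjunct2])
    show "\<forall>\<^sub>F (i, N) in sequentially \<times>\<^sub>F sequentially.
        norm (c N (d i) * theta_term z q (d i)) \<le> K1 * (K2 * K2) * norm (theta_term z q (d i))"
      by (intro always_eventually) (auto simp: norm_mult intro!: mult_right_mono c_bound)
    show "summable (\<lambda>i. K1 * (K2 * K2) * norm (theta_term z q (d i)))"
      by (intro summable_mult sm)
    show "(\<lambda>N. c N (d i) * theta_term z q (d i)) \<longlonglongrightarrow> 1 / ?E * theta_term z q (d i)" for i
      by (intro tendsto_intros c_lim)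
  qed auto
  moreover have "(\<Sum>i. c N (d i) * theta_term z q (d i))
      = (\<Prod>k<N. 1 - z * q ^ k) * (\<Prod>k<N. 1 - (q / z) * q ^ k)" for N
  proof -
    have "((\<lambda>j. c N j * theta_term z q j) has_sum
        (\<Prod>k<N. 1 - z * q ^ k) * (\<Prod>k<N. 1 - (q / z) * q ^ k)) UNIV"
      unfolding finite_triple_product[OF assms(1,3)]
      by (rule has_sum_finite_neutralI[of "{-int N..int N}"]) (auto simp: c_def intro!: sum.cong)
    hence "((\<lambda>i. c N (d i) * theta_term z q (d i)) has_sum
        (\<Prod>k<N. 1 - z * q ^ k) * (\<Prod>k<N. 1 - (q / z) * q ^ k)) UNIV"
      using has_sum_reindex_bij_betw[OF d, of "\<lambda>j. c N j * theta_term z q j"] by simp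
    thus ?thesis by (intro sums_unique[symmetric] has_sum_imp_sums)
  qed
  moreover have "(\<lambda>N. (\<Prod>k<N. 1 - z * q ^ k) * (\<Prod>k<N. 1 - (q / z) * q ^ k))
      \<longlonglongrightarrow> qpochhammer_inf z q * qpochhammer_inf (q / z) q"
    by (intro tendsto_intros qpochhammer_inf_LIMSEQ assms)
  ultimately have "(\<Sum>i. 1 / ?E * theta_term z q (d i)) = qpochhammer_inf z q * qpochhammer_inf (q / z) q"
    using LIMSEQ_unique by force
  hence "(\<Sum>i. theta_term z q (d i)) = theta z q"
    using E0 suminf_mult[OF summable_norm_cancel[OF sm], of "1 / ?E"]
    by (simp add: theta_def field_simps)
  hence "(\<lambda>i. theta_term z q (d i)) sums theta z q"
    using summable_norm_cancel[OF sm] by (simp add: sums_iff)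
  hence "((\<lambda>i. theta_term z q (d i)) has_sum theta z q) UNIV"
    using sm by (intro norm_summable_imp_has_sum)
  thus ?thesis using has_sum_reindex_bij_betw[OF d, of "theta_term z q"] by simp
qed

section \<open>The quintuple product\<close>

lemma has_sum_times_abs:
  fixes f :: "'a \<Rightarrow> complex" and g :: "'b \<Rightarrow> complex"
  assumes "(f has_sum a) A" "(g has_sum b) B"
    and "(\<lambda>x. norm (f x)) summable_on A" "(\<lambda>y. norm (g y)) summable_on B"
  shows "((\<lambda>(x, y). f x * g y) has_sum a * b) (A \<times> B)"
proof (rule has_sum_SigmaI[where g = "\<lambda>x. f x * b"])
  show "((\<lambda>y. case (x, y) of (x, y) \<Rightarrow> f x * g y) has_sum f x * b) B" for x
    using has_sum_cmult_right[OF assms(2)] by simp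
  show "((\<lambda>x. f x * b) has_sum a * b) A"
    by (rule has_sum_cmult_left[OF assms(1)])
  have "(\<lambda>p. norm (case p of (x, y) \<Rightarrow> f x * g y)) summable_on A \<times> B"
  proof (rule summable_on_SigmaI[where g = "\<lambda>x. norm (f x) * infsum (\<lambda>y. norm (g y)) B"])
    show "((\<lambda>y. norm (case (x, y) of (x, y) \<Rightarrow> f x * g y)) has_sum
        norm (f x) * infsum (\<lambda>y. norm (g y)) B) B" for x
      using has_sum_cmult_right[OF has_sum_infsum[OF assms(4)]] by (simp add: norm_mult)
    show "(\<lambda>x. norm (f x) * infsum (\<lambda>y. norm (g y)) B) summable_on A"
      by (rule summable_on_cmult_left[OF assms(3)])
  qed auto
  thus "(\<lambda>(x, y). f x * g y) summable_on A \<times> B"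
    by (rule abs_summable_summable)
qed

text \<open>Trades the integer division for a variable \<open>c\<close>, so that identities between
  exponents become polynomial.\<close>

lemma triangleE:
  fixes n :: int
  obtains c where "n * (n - 1) div 2 = c" "n * (n - 1) = 2 * c"
  using half_pronic_double[of n] by metis

lemma theta_term_monomial:
  assumes "z \<noteq> 0" "q \<noteq> 0"
  shows "theta_term (z powi a * q powi b) (q powi d) n
       = (-1) powi n * z powi (a * n) * q powi (b * n + d * (n * (n - 1) div 2))"
proof -
  have "(- (z powi a * q powi b)) powi n = (-1) powi n * (z powi a) powi n * (q powi b) powi n"
    by (metis mult_minus1 power_int_mult_distrib mult.assoc)
  thus ?thesis
    using assms by (simp add: theta_term_def power_int_add power_int_mult mult_ac)
qed

lemma theta_term_minus: "theta_term (-z) q n = (-1) powi n * theta_term z q n"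
proof -
  have "z powi n = (-1) powi n * (-z) powi n"
    by (metis minus_mult_minus mult_1 power_int_mult_distrib)
  thus ?thesis by (simp add: theta_term_def)
qed

lemma minus_one_powi_even: "(-1 :: complex) powi (2 * k) = 1"
  by (simp add: power_int_mult)

lemma minus_one_powi_twice: "(-1 :: complex) powi k * (-1) powi k = 1"
  by (simp flip: power_int_mult_distrib)

lemma theta_inverse:
  assumes "z \<noteq> 0" "q \<noteq> 0"
  shows "theta (q / z) q = theta z q"
  using assms by (simp add: theta_def)

text \<open>One factor moves at each end of the product, and 1 - 1/z = -(1 - z)/z.\<close>

lemma theta_shift:
  assumes "z \<noteq> 0" "norm q < 1" "q \<noteq> 0"
  shows "theta (z * q) q = - theta z q / z"
proof -
  have "theta (z * q) q = qpochhammer_inf (z * q) q * qpochhammer_inf (1 / z) q * qpochhammer_inf q q"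
    using assms by (simp add: theta_def)
  also have "qpochhammer_inf (1 / z) q = (1 - 1 / z) * qpochhammer_inf (q / z) q"
    using qpochhammer_inf_rec[OF assms(2), of "1 / z"] by simp
  finally show ?thesis
    using assms by (simp add: theta_def qpochhammer_inf_rec[OF assms(2), of z] field_simps)
qed

lemma theta_one: "norm q < 1 \<Longrightarrow> theta 1 q = 0"
  by (simp add: theta_def qpochhammer_inf_rec[of q 1])

text \<open>The two theta series on the left are multiplied out and sorted by the exponent of
  \<open>z\<close> modulo 3. Each class is again a product of two theta functions; class 2 contains
  \<open>theta 1 (q ^ 6) = 0\<close>, and the other two share the factor
  \<open>theta (q ^ 4) (q ^ 6)\<close>.\<close>

theorem quintuple_product:
  assumes "q \<noteq> 0" "norm q < 1" "z \<noteq> 0"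
  shows "theta z q * theta (z\<^sup>2 * q) (q\<^sup>2)
       = theta (q ^ 4) (q ^ 6) * (theta (- (z ^ 3 * q)) (q ^ 3) - z * theta (- (z ^ 3 * q\<^sup>2)) (q ^ 3))"
proof -
  have pw: "norm (q ^ k) < 1" if "k > 0" for k
    using assms that by (simp add: norm_power power_less_one_iff)
  define F where "F = (\<lambda>(r, s). theta_term z q r * theta_term (z\<^sup>2 * q) (q\<^sup>2) s)"
  have F_sum: "(F has_sum theta z q * theta (z\<^sup>2 * q) (q\<^sup>2)) (UNIV \<times> UNIV)"
    unfolding F_def
    by (intro has_sum_times_abs jacobi_triple_product abs_summable_theta_term)
       (use assms pw in auto)
  have F_eq: "F (r, s) = (-1) powi (r + s) * z powi (r + 2 * s)
      * q powi (r * (r - 1) div 2 + s + 2 * (s * (s - 1) div 2))" for r s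
    using theta_term_monomial[of z q 1 0 1 r] theta_term_monomial[of z q 2 1 2 s] assms
    by (simp add: F_def power_int_add mult_ac)
  \<comment> \<open>In the double series, the exponent of \<open>z\<close> is \<open>r + 2 s = 3 m + i\<close>; with \<open>s = m + t\<close> the exponent of \<open>q\<close>
      separates into a function of \<open>m\<close> and one of \<open>t\<close>.\<close>
  define h :: "nat \<times> (int \<times> int) \<Rightarrow> int \<times> int" where "h = (\<lambda>(i, m, t). (m - 2 * t + int i, m + t))"
  have h: "bij_betw h ({..<3} \<times> UNIV) (UNIV \<times> UNIV)"
  proof (rule bij_betwI[where g = "\<lambda>(r, s). (nat ((r + 2 * s) mod 3), (r + 2 * s) div 3, s - (r + 2 * s) div 3)"])
    fix p assume "p \<in> {..<3::nat} \<times> (UNIV :: (int \<times> int) set)"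
    then obtain i m t where p: "p = (i, m, t)" "i < 3" by auto
    have "m - 2 * t + int i + 2 * (m + t) = int i + 3 * m" by simp
    thus "(case h p of (r, s) \<Rightarrow> (nat ((r + 2 * s) mod 3), (r + 2 * s) div 3, s - (r + 2 * s) div 3)) = p"
      using p(2) unfolding h_def p(1) prod.case by simp
  next
    fix p :: "int \<times> int"
    obtain r s where p: "p = (r, s)" by (cases p)
    have "(r + 2 * s) mod 3 \<ge> 0" by simp
    thus "h (case p of (r, s) \<Rightarrow> (nat ((r + 2 * s) mod 3), (r + 2 * s) div 3, s - (r + 2 * s) div 3)) = p"
      unfolding h_def p prod.case by simp presburger
  qed auto
  define V where "V i = (case i of 0 \<Rightarrow> theta (- (z ^ 3 * q)) (q ^ 3) * theta (q ^ 4) (q ^ 6)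
    | Suc 0 \<Rightarrow> - z * theta (- (z ^ 3 * q\<^sup>2)) (q ^ 3) * theta (q\<^sup>2) (q ^ 6)
    | _ \<Rightarrow> z\<^sup>2 * q * theta (- (z ^ 3 * q ^ 3)) (q ^ 3) * theta 1 (q ^ 6))" for i :: nat
  have fiber: "((\<lambda>p. F (h (i, p))) has_sum V i) UNIV" if "i < 3" for i
  proof -
    have tm: "theta_term (- (z ^ 3 * q ^ k)) (q ^ 3) m
        = z powi (3 * m) * q powi (int k * m + 3 * (m * (m - 1) div 2))" for k m
      using theta_term_monomial[of z q 3 "int k" 3 m] assms minus_one_powi_twice[of m]
      by (simp add: theta_term_minus)
    have tt: "theta_term (q ^ k) (q ^ 6) t
        = (-1) powi t * q powi (int k * t + 6 * (t * (t - 1) div 2))" for k t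
      using theta_term_monomial[of z q 0 "int k" 6 t] assms by simp
    have sgn: "(-1 :: complex) powi (m - 2 * t + int i + (m + t)) = (-1) ^ i * (-1) powi t" for m t
    proof -
      have "m - 2 * t + int i + (m + t) = 2 * (m - t) + t + int i" by simp
      moreover have "(-1 :: complex) powi (a + b) = (-1) powi a * (-1) powi b" for a b
        by (simp add: power_int_add)
      ultimately show ?thesis by (simp only: minus_one_powi_even power_int_of_nat) simp
    qed
    have ex: "(m - 2 * t + int i) * (m - 2 * t + int i - 1) div 2 + (m + t) + 2 * ((m + t) * (m + t - 1) div 2)
       = int i * (int i - 1) div 2 + ((int i + 1) * m + 3 * (m * (m - 1) div 2))
         + ((4 - 2 * int i) * t + 6 * (t * (t - 1) div 2))" for m t
    proof -
      obtain a where a: "(m - 2 * t + int i) * (m - 2 * t + int i - 1) div 2 = a"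
          "(m - 2 * t + int i) * (m - 2 * t + int i - 1) = 2 * a"
        by (rule triangleE)
      obtain b where b: "(m + t) * (m + t - 1) div 2 = b" "(m + t) * (m + t - 1) = 2 * b"
        by (rule triangleE)
      obtain c where c: "int i * (int i - 1) div 2 = c" "int i * (int i - 1) = 2 * c"
        by (rule triangleE)
      obtain d where d: "m * (m - 1) div 2 = d" "m * (m - 1) = 2 * d"
        by (rule triangleE)
      obtain e where e: "t * (t - 1) div 2 = e" "t * (t - 1) = 2 * e"
        by (rule triangleE)
      show ?thesis
        unfolding a(1) b(1) c(1) d(1) e(1)
        using a(2) b(2) c(2) d(2) e(2) by (simp add: algebra_simps)
    qed
    have zx: "m - 2 * t + int i + 2 * (m + t) = 3 * m + int i" for m t by simp
    have *: "F (h (i, p)) = (- z) ^ i * q ^ (i * (i - 1) div 2) * 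
        (case p of (m, t) \<Rightarrow> theta_term (- (z ^ 3 * q ^ (i + 1))) (q ^ 3) m * theta_term (q ^ (4 - 2 * i)) (q ^ 6) t)" for p
    proof -
      obtain m t where p: "p = (m, t)" by (cases p)
      have i2: "int (4 - 2 * i) = 4 - 2 * int i" using that by simp
      show ?thesis
        unfolding p h_def prod.case F_eq sgn ex zx tm tt i2 half_pronic_of_nat
        using assms by (simp add: power_int_add power_minus[of z] mult_ac add.commute[of 1] del: of_nat_div)
    qed
    have "((\<lambda>p. case p of (m, t) \<Rightarrow> theta_term (- (z ^ 3 * q ^ (i + 1))) (q ^ 3) m * theta_term (q ^ (4 - 2 * i)) (q ^ 6) t)
        has_sum theta (- (z ^ 3 * q ^ (i + 1))) (q ^ 3) * theta (q ^ (4 - 2 * i)) (q ^ 6)) (UNIV \<times> UNIV)"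
      by (intro has_sum_times_abs jacobi_triple_product abs_summable_theta_term)
         (use assms pw in auto)
    hence "((\<lambda>p. F (h (i, p))) has_sum (- z) ^ i * q ^ (i * (i - 1) div 2) *
       (theta (- (z ^ 3 * q ^ (i + 1))) (q ^ 3) * theta (q ^ (4 - 2 * i)) (q ^ 6))) UNIV"
      unfolding * UNIV_Times_UNIV by (rule has_sum_cmult_right)
    moreover have "i = 0 \<or> i = 1 \<or> i = 2" using that by auto
    hence "(- z) ^ i * q ^ (i * (i - 1) div 2) *
       (theta (- (z ^ 3 * q ^ (i + 1))) (q ^ 3) * theta (q ^ (4 - 2 * i)) (q ^ 6)) = V i"
      by (auto simp: V_def numeral_2_eq_2 numeral_3_eq_3)
    ultimately show ?thesis by simp
  qed
  have "((\<lambda>p. F (h p)) has_sum theta z q * theta (z\<^sup>2 * q) (q\<^sup>2)) ({..<3} \<times> UNIV)"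
    using F_sum has_sum_reindex_bij_betw[OF h, of F] by simp
  hence "(V has_sum theta z q * theta (z\<^sup>2 * q) (q\<^sup>2)) {..<3}"
    by (rule has_sum_SigmaD) (use fiber in auto)
  hence "theta z q * theta (z\<^sup>2 * q) (q\<^sup>2) = (\<Sum>i<3. V i)"
    by (simp add: has_sum_finite_iff)
  also have "\<dots> = V 0 + V 1 + V 2"
    by (simp add: eval_nat_numeral)
  also have "V 2 = 0"
    using theta_one[OF pw[of 6]] by (simp add: V_def numeral_2_eq_2)
  also have "theta (q\<^sup>2) (q ^ 6) = theta (q ^ 4) (q ^ 6)"
    using theta_inverse[of "q ^ 4" "q ^ 6"] assms by (simp flip: power_diff)
  hence "V 1 = - z * theta (- (z ^ 3 * q\<^sup>2)) (q ^ 3) * theta (q ^ 4) (q ^ 6)"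
    by (simp add: V_def)
  finally show ?thesis by (simp add: V_def algebra_simps)
qed

section \<open>The 5-dissection of Euler's product\<close>

text \<open>Sorting the series by \<open>n = 5 * m + i\<close>: since 5 is odd, (-1)^(5m) = (-1)^m,
  and the sum over \<open>m\<close> is again a theta series.\<close>

lemma theta_dissection_5:
  assumes "q \<noteq> 0" "norm q < 1" "z \<noteq> 0"
  shows "theta z q = (\<Sum>i<5. theta_term z q (int i) * theta (z ^ 5 * q ^ (10 + 5 * i)) (q ^ 25))"
proof -
  have q25: "norm (q ^ 25) < 1"
    using assms by (simp add: norm_power power_less_one_iff)
  define h :: "nat \<times> int \<Rightarrow> int" where "h = (\<lambda>(i, m). 5 * m + int i)"
  have h: "bij_betw h ({..<5} \<times> UNIV) UNIV"
  proof (rule bij_betwI[where g = "\<lambda>n. (nat (n mod 5), n div 5)"])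
    fix p assume "p \<in> {..<5::nat} \<times> (UNIV :: int set)"
    then obtain i m where p: "p = (i, m)" "i < 5" by auto
    have "5 * m + int i = int i + 5 * m" by simp
    thus "(nat (h p mod 5), h p div 5) = p"
      using p(2) unfolding h_def p(1) prod.case by simp
  qed (auto simp: h_def)
  have eq: "theta_term z q (h (i, m)) = theta_term z q (int i) * theta_term (z ^ 5 * q ^ (10 + 5 * i)) (q ^ 25) m" for i m
  proof -
    obtain a where a: "(5 * m + int i) * (5 * m + int i - 1) div 2 = a"
        "(5 * m + int i) * (5 * m + int i - 1) = 2 * a"
      by (rule triangleE)
    obtain c where c: "int i * (int i - 1) div 2 = c" "int i * (int i - 1) = 2 * c"
      by (rule triangleE)
    obtain d where d: "m * (m - 1) div 2 = d" "m * (m - 1) = 2 * d"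
      by (rule triangleE)
    have ex: "a = c + (10 + 5 * int i) * m + 25 * d"
      using a(2) c(2) d(2) by (simp add: algebra_simps)
    have "theta_term (z ^ 5 * q ^ (10 + 5 * i)) (q ^ 25) m
        = (-1) powi m * z powi (5 * m) * q powi ((10 + 5 * int i) * m + 25 * d)"
      using theta_term_monomial[of z q 5 "int (10 + 5 * i)" 25 m] assms unfolding d(1) power_int_of_nat by simp
    moreover have "(-1 :: complex) powi m = (-1) powi (5 * m)"
      by (simp add: power_int_mult)
    ultimately have "theta_term (z ^ 5 * q ^ (10 + 5 * i)) (q ^ 25) m
        = (-z) powi (5 * m) * q powi ((10 + 5 * int i) * m + 25 * d)"
      by (metis mult_minus1 power_int_mult_distrib)
    thus ?thesis
      using assms unfolding theta_term_def h_def prod.case a(1) c(1) ex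
      by (simp add: power_int_add)
  qed
  have "((\<lambda>p. theta_term z q (h p)) has_sum theta z q) ({..<5} \<times> UNIV)"
    using jacobi_triple_product[OF assms] has_sum_reindex_bij_betw[OF h, of "theta_term z q"] by simp
  hence "((\<lambda>i. theta_term z q (int i) * theta (z ^ 5 * q ^ (10 + 5 * i)) (q ^ 25)) has_sum theta z q) {..<5}"
  proof (rule has_sum_SigmaD)
    show "((\<lambda>m. theta_term z q (h (i, m))) has_sum
        theta_term z q (int i) * theta (z ^ 5 * q ^ (10 + 5 * i)) (q ^ 25)) UNIV" for i
      unfolding eq
      by (intro has_sum_cmult_right jacobi_triple_product) (use assms q25 in auto)
  qed
  thus ?thesis by (simp add: has_sum_finite_iff)
qed

text \<open>The exponents 1, 2 and 0 modulo 3 are the three factors of a theta function of base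
  \<open>q ^ 3\<close>, as in the pentagonal number theorem.\<close>

lemma qpochhammer_inf_eq_theta:
  assumes "q \<noteq> 0" "norm q < 1"
  shows "qpochhammer_inf q q = theta q (q ^ 3)" "qpochhammer_inf q q = theta (q\<^sup>2) (q ^ 3)"
proof -
  have "qpochhammer_inf q q = qpochhammer_inf q (q ^ 3) * qpochhammer_inf (q\<^sup>2) (q ^ 3) * qpochhammer_inf (q ^ 3) (q ^ 3)"
    using qpochhammer_inf_split[OF assms(2), of 3 q] by (simp add: eval_nat_numeral mult_ac)
  moreover have "q ^ 3 / q = q\<^sup>2" "q ^ 3 / q\<^sup>2 = q"
    using assms by (simp_all add: eval_nat_numeral)
  ultimately show "qpochhammer_inf q q = theta q (q ^ 3)" "qpochhammer_inf q q = theta (q\<^sup>2) (q ^ 3)"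
    by (simp_all add: theta_def)
qed

text \<open>This is \<open>theta_dissection_5\<close> at \<open>z = q\<close> with base
  \<open>q ^ 3\<close>. Its terms \<open>i = 0\<close> and \<open>i = 2\<close> have exponents 0
  modulo 5, \<open>i = 1\<close> has exponents 1, and \<open>i = 3\<close>, \<open>i = 4\<close>
  have exponents 2.\<close>

lemma euler_dissection_theta:
  assumes "q \<noteq> 0" "norm q < 1"
  defines "Q \<equiv> q ^ 5"
  shows "qpochhammer_inf q q = (theta (Q ^ 8) (Q ^ 15) + Q * theta (Q ^ 13) (Q ^ 15))
    - q * qpochhammer_inf (Q ^ 5) (Q ^ 5) - q\<^sup>2 * (theta (Q ^ 11) (Q ^ 15) + Q\<^sup>2 * theta (Q ^ 16) (Q ^ 15))"
proof -
  have pw: "norm (q ^ k) < 1" if "k > 0" for k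
    using assms that by (simp add: norm_power power_less_one_iff)
  have Q: "Q \<noteq> 0" "norm Q < 1" using assms pw[of 5] by (simp_all add: Q_def)
  have pwQ: "norm (Q ^ k) < 1" if "k > 0" for k
    using Q that by (simp add: norm_power power_less_one_iff)
  have tq: "theta_term q (q ^ 3) 0 = 1" "theta_term q (q ^ 3) 1 = - q" "theta_term q (q ^ 3) 2 = Q"
    "theta_term q (q ^ 3) 3 = - q\<^sup>2 * Q\<^sup>2" "theta_term q (q ^ 3) 4 = q\<^sup>2 * Q ^ 4"
    by (simp_all add: theta_term_def Q_def flip: power_add power_mult power_Suc)
  have "qpochhammer_inf q q = theta q (q ^ 3)"
    by (rule qpochhammer_inf_eq_theta) (use assms in auto)
  also have "\<dots> = (\<Sum>i<5. theta_term q (q ^ 3) (int i) * theta (q ^ 5 * (q ^ 3) ^ (10 + 5 * i)) ((q ^ 3) ^ 25))"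
    by (rule theta_dissection_5) (use assms pw in auto)
  also have "\<dots> = theta (Q ^ 7) (Q ^ 15) - q * theta (Q ^ 10) (Q ^ 15) + Q * theta (Q ^ 13) (Q ^ 15)
      - q\<^sup>2 * Q\<^sup>2 * theta (Q ^ 16) (Q ^ 15) + q\<^sup>2 * Q ^ 4 * theta (Q ^ 19) (Q ^ 15)"
  proof -
    have "q ^ 5 * (q ^ 3) ^ (10 + 5 * i) = Q ^ (7 + 3 * i)" for i
      unfolding Q_def power_mult[symmetric] power_add[symmetric] by (simp add: algebra_simps)
    moreover have "(q ^ 3) ^ 25 = Q ^ 15"
      by (simp add: Q_def flip: power_mult)
    moreover have "(\<Sum>i<5. g i) = g 0 + g 1 + g 2 + g 3 + g 4" for g :: "nat \<Rightarrow> complex"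
      by (simp add: eval_nat_numeral)
    ultimately show ?thesis
      by (simp add: tq)
  qed
  also have "theta (Q ^ 7) (Q ^ 15) = theta (Q ^ 8) (Q ^ 15)"
    using theta_inverse[of "Q ^ 8" "Q ^ 15"] Q by (simp flip: power_diff)
  also have "theta (Q ^ 10) (Q ^ 15) = qpochhammer_inf (Q ^ 5) (Q ^ 5)"
    using qpochhammer_inf_eq_theta(2)[of "Q ^ 5"] Q pwQ by (simp flip: power_mult)
  \<comment> \<open>\<open>theta_shift\<close> brings \<open>Q ^ 19\<close> down to
    \<open>Q ^ 4\<close>, which \<open>theta_inverse\<close> reflects to
    \<open>Q ^ 11\<close>.\<close>
  also have "Q ^ 4 * theta (Q ^ 19) (Q ^ 15) = - theta (Q ^ 11) (Q ^ 15)"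
    using theta_shift[of "Q ^ 4" "Q ^ 15"] theta_inverse[of "Q ^ 11" "Q ^ 15"] Q pwQ
    by (simp flip: power_add power_diff)
  hence "q\<^sup>2 * Q ^ 4 * theta (Q ^ 19) (Q ^ 15) = - q\<^sup>2 * theta (Q ^ 11) (Q ^ 15)"
    by (simp only: mult.assoc) simp
  finally show ?thesis by (simp add: algebra_simps)
qed

text \<open>The reciprocals of \<open>rr_num\<close> and \<open>rr_den\<close> are the
  Rogers-Ramanujan functions G and H.\<close>

definition rr_num :: "complex \<Rightarrow> complex" where
  "rr_num q = qpochhammer_inf q (q ^ 5) * qpochhammer_inf (q ^ 4) (q ^ 5)"

definition rr_den :: "complex \<Rightarrow> complex" where
  "rr_den q = qpochhammer_inf (q\<^sup>2) (q ^ 5) * qpochhammer_inf (q ^ 3) (q ^ 5)"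

lemma rogers_ramanujan_R_eq: "rogers_ramanujan_R q = rr_num q / rr_den q"
  by (simp add: rogers_ramanujan_R_def rr_num_def rr_den_def)

lemma norm_power_less_one: "norm q < 1 \<Longrightarrow> k > 0 \<Longrightarrow> norm (q ^ k) < 1" for q :: complex
  by (simp add: norm_power power_less_one_iff)

lemma rr_num_nonzero: "norm q < 1 \<Longrightarrow> rr_num q \<noteq> 0"
  by (simp add: rr_num_def qpochhammer_inf_nonzero norm_power_less_one)

lemma rr_den_nonzero: "norm q < 1 \<Longrightarrow> rr_den q \<noteq> 0"
  by (simp add: rr_den_def qpochhammer_inf_nonzero norm_power_less_one)

lemma euler_eq_rr_num_den:
  assumes "norm q < 1"
  shows "qpochhammer_inf q q = rr_num q * rr_den q * qpochhammer_inf (q ^ 5) (q ^ 5)"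
proof -
  have "(\<Prod>i<5. g i) = g 0 * g 1 * g 2 * g 3 * g 4" for g :: "nat \<Rightarrow> complex"
    by (simp add: eval_nat_numeral)
  moreover have "q * q ^ 1 = q\<^sup>2" "q * q\<^sup>2 = q ^ 3" "q * q ^ 3 = q ^ 4" "q * q ^ 4 = q ^ 5"
    by (simp_all add: eval_nat_numeral)
  ultimately have "qpochhammer_inf q q = qpochhammer_inf (q * q ^ 0) (q ^ 5) * qpochhammer_inf (q\<^sup>2) (q ^ 5)
      * qpochhammer_inf (q ^ 3) (q ^ 5) * qpochhammer_inf (q ^ 4) (q ^ 5) * qpochhammer_inf (q ^ 5) (q ^ 5)"
    using qpochhammer_inf_split[OF assms, of 5 q] by (simp only: zero_less_numeral if_True simp_thms)
  thus ?thesis by (simp add: rr_num_def rr_den_def mult_ac)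
qed

text \<open>The quintuple product of base \<open>Q ^ 5\<close>, at -Q and at -Q^2, turns the two
  brackets of the 5-dissection into products.\<close>

lemma quintuple_rr:
  assumes "Q \<noteq> 0" "norm Q < 1"
  shows "rr_num Q * (theta (Q ^ 8) (Q ^ 15) + Q * theta (Q ^ 13) (Q ^ 15))
           = rr_den Q * qpochhammer_inf (Q ^ 5) (Q ^ 5)" (is ?th1)
    and "rr_den Q * (theta (Q ^ 11) (Q ^ 15) + Q\<^sup>2 * theta (Q ^ 16) (Q ^ 15))
           = rr_num Q * qpochhammer_inf (Q ^ 5) (Q ^ 5)" (is ?th2)
proof -
  note pw = norm_power_less_one[OF assms(2)]
  let ?f = "\<lambda>a. qpochhammer_inf (Q ^ a) (Q ^ 5)" and ?g = "\<lambda>a. qpochhammer_inf (Q ^ a) (Q ^ 10)"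
    and ?m = "\<lambda>a. qpochhammer_inf (- (Q ^ a)) (Q ^ 5)"
  \<comment> \<open>\<open>dbl\<close> absorbs the symbols with changed sign and \<open>spl\<close>
    splits exponents by parity; together they rewrite everything in base
    \<open>Q ^ 10\<close>.\<close>
  have dbl: "?f a * ?m a = ?g (2 * a)" for a
    using qpochhammer_inf_mult_minus[OF pw[of 5], of "Q ^ a"]
    by (simp add: mult.commute[of a] flip: power_mult)
  have spl: "?f a = ?g a * ?g (a + 5)" for a
  proof -
    have "(\<Prod>i<2. g i) = g 0 * g 1" for g :: "nat \<Rightarrow> complex"
      by (simp add: numeral_2_eq_2)
    thus ?thesis
      using qpochhammer_inf_split[OF pw[of 5], of 2 "Q ^ a"]
      by (simp flip: power_mult power_add)
  qed
  have e: "theta (Q ^ 20) (Q ^ 30) = ?g 10"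
    using qpochhammer_inf_eq_theta(2)[of "Q ^ 10"] assms pw by (simp flip: power_mult)
  have e0: "?g 10 \<noteq> 0"
    by (intro qpochhammer_inf_nonzero) (use pw in auto)
  have "theta (- Q) (Q ^ 5) * theta (Q ^ 7) (Q ^ 10)
      = ?g 10 * (theta (Q ^ 8) (Q ^ 15) + Q * theta (Q ^ 13) (Q ^ 15))"
    using quintuple_product[of "Q ^ 5" "- Q"] assms pw e
    by (simp flip: power_mult power_add)
  moreover have "theta (- Q) (Q ^ 5) = ?m 1 * ?m 4 * ?f 5"
    using assms by (simp add: theta_def minus_divide_right[symmetric] eval_nat_numeral)
  moreover have "theta (Q ^ 7) (Q ^ 10) = ?g 7 * ?g 3 * ?g 10"
    using assms by (simp add: theta_def flip: power_diff)
  ultimately have "?m 1 * ?m 4 * ?f 5 * (?g 7 * ?g 3)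
      = theta (Q ^ 8) (Q ^ 15) + Q * theta (Q ^ 13) (Q ^ 15)"
    using e0 by (simp add: mult.assoc)
  moreover have "rr_num Q * (?m 1 * ?m 4 * ?f 5 * (?g 7 * ?g 3)) = (?f 1 * ?m 1) * (?f 4 * ?m 4) * ?f 5 * (?g 7 * ?g 3)"
    by (simp add: rr_num_def mult_ac)
  moreover have "\<dots> = rr_den Q * ?f 5"
    unfolding dbl rr_den_def spl[of 2] spl[of 3] by simp
  ultimately show ?th1 by metis
  have "theta (- (Q\<^sup>2)) (Q ^ 5) * theta (Q ^ 9) (Q ^ 10)
      = ?g 10 * (theta (Q ^ 11) (Q ^ 15) + Q\<^sup>2 * theta (Q ^ 16) (Q ^ 15))"
    using quintuple_product[of "Q ^ 5" "- (Q\<^sup>2)"] assms pw e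
    by (simp flip: power_mult power_add)
  moreover have "theta (- (Q\<^sup>2)) (Q ^ 5) = ?m 2 * ?m 3 * ?f 5"
    using assms by (simp add: theta_def minus_divide_right[symmetric] eval_nat_numeral)
  moreover have "theta (Q ^ 9) (Q ^ 10) = ?g 9 * ?g 1 * ?g 10"
    using assms by (simp add: theta_def eval_nat_numeral)
  ultimately have "?m 2 * ?m 3 * ?f 5 * (?g 9 * ?g 1)
      = theta (Q ^ 11) (Q ^ 15) + Q\<^sup>2 * theta (Q ^ 16) (Q ^ 15)"
    using e0 by (simp add: mult.assoc)
  moreover have "rr_den Q * (?m 2 * ?m 3 * ?f 5 * (?g 9 * ?g 1)) = (?f 2 * ?m 2) * (?f 3 * ?m 3) * ?f 5 * (?g 9 * ?g 1)"
    by (simp add: rr_den_def mult_ac)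
  moreover have "\<dots> = rr_num Q * ?f 5"
    unfolding dbl rr_num_def using spl[of 1] spl[of 4] by simp
  ultimately show ?th2 by metis
qed

theorem euler_dissection:
  assumes "q \<noteq> 0" "norm q < 1"
  defines "R \<equiv> rogers_ramanujan_R (q ^ 5)"
  shows "qpochhammer_inf q q = qpochhammer_inf (q ^ 25) (q ^ 25) * (1 / R - q - q\<^sup>2 * R)"
proof -
  have Q: "q ^ 5 \<noteq> 0" "norm (q ^ 5) < 1"
    using assms norm_power_less_one by auto
  show ?thesis
  proof -
    let ?E = "qpochhammer_inf ((q ^ 5) ^ 5) ((q ^ 5) ^ 5)"
    have "theta ((q ^ 5) ^ 8) ((q ^ 5) ^ 15) + q ^ 5 * theta ((q ^ 5) ^ 13) ((q ^ 5) ^ 15) = ?E * (1 / R)"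
      using quintuple_rr(1)[OF Q] rr_num_nonzero[OF Q(2)] rr_den_nonzero[OF Q(2)]
      by (simp add: R_def rogers_ramanujan_R_eq nonzero_eq_divide_eq mult_ac)
    moreover have "theta ((q ^ 5) ^ 11) ((q ^ 5) ^ 15) + (q ^ 5)\<^sup>2 * theta ((q ^ 5) ^ 16) ((q ^ 5) ^ 15) = ?E * R"
      using quintuple_rr(2)[OF Q] rr_num_nonzero[OF Q(2)] rr_den_nonzero[OF Q(2)]
      by (simp add: R_def rogers_ramanujan_R_eq nonzero_eq_divide_eq mult_ac)
    ultimately have "qpochhammer_inf q q = ?E * (1 / R) - q * ?E - q\<^sup>2 * (?E * R)"
      using euler_dissection_theta[OF assms(1,2)] by simp
    moreover have "?E = qpochhammer_inf (q ^ 25) (q ^ 25)"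
      by (simp flip: power_mult)
    ultimately show ?thesis by (simp add: algebra_simps)
  qed
qed

section \<open>The modular equation of degree 5\<close>

text \<open>Conjugate roots are paired: \<open>w\<close> with \<open>w ^ 4\<close> and
  \<open>w ^ 2\<close> with \<open>w ^ 3\<close>. The two pair sums have sum and product -1.\<close>

lemma prod_roots_of_unity_5:
  fixes w x :: complex
  assumes "w ^ 5 = 1" "w \<noteq> 1"
  shows "(\<Prod>j<5. 1 - w ^ j * x) = 1 - x ^ 5"
proof -
  define a b where "a = w + w ^ 4" and "b = w ^ 2 + w ^ 3"
  have "(w - 1) * (1 + w + w ^ 2 + w ^ 3 + w ^ 4) = w ^ 5 - 1"
    by algebra
  hence "1 + w + w ^ 2 + w ^ 3 + w ^ 4 = 0"
    using assms by simp
  hence sum: "a + b = -1"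
    unfolding a_def b_def by algebra
  have "a * b = w ^ 3 + w ^ 4 + w ^ 5 * (w + w ^ 2)"
    unfolding a_def b_def by algebra
  also have "\<dots> = a + b"
    unfolding assms(1) a_def b_def by simp
  finally have prod: "a * b = -1"
    unfolding sum .
  have "(1 - w * x) * (1 - w ^ 4 * x) = 1 - a * x + w ^ 5 * x ^ 2"
    unfolding a_def by algebra
  moreover have "(1 - w ^ 2 * x) * (1 - w ^ 3 * x) = 1 - b * x + w ^ 5 * x ^ 2"
    unfolding b_def by algebra
  moreover have "(\<Prod>j<5. 1 - w ^ j * x)
      = (1 - x) * (((1 - w * x) * (1 - w ^ 4 * x)) * ((1 - w ^ 2 * x) * (1 - w ^ 3 * x)))"
  proof -
    have "(\<Prod>j<5. g j) = g 0 * g 1 * g 2 * g 3 * g 4" for g :: "nat \<Rightarrow> complex"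
      by (simp add: eval_nat_numeral)
    thus ?thesis by (simp add: mult_ac)
  qed
  ultimately have "(\<Prod>j<5. 1 - w ^ j * x)
      = (1 - x) * ((1 - a * x + x ^ 2) * (1 - b * x + x ^ 2))"
    using assms(1) by simp
  also have "(1 - a * x + x ^ 2) * (1 - b * x + x ^ 2)
      = 1 - (a + b) * x + (2 + a * b) * x ^ 2 - (a + b) * x ^ 3 + x ^ 4"
    by algebra
  also have "\<dots> = 1 + x + x ^ 2 + x ^ 3 + x ^ 4"
    unfolding sum prod by simp
  also have "(1 - x) * \<dots> = 1 - x ^ 5"
    by algebra
  finally show ?thesis .
qed

lemma qpochhammer_inf_prod_roots:
  assumes "w ^ 5 = 1" "w \<noteq> 1" "norm p < 1"
  shows "(\<Prod>j<5. qpochhammer_inf (w ^ j * x) p) = qpochhammer_inf (x ^ 5) (p ^ 5)"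
proof -
  have p5: "norm (p ^ 5) < 1"
    using assms norm_power_less_one by simp
  have "(\<lambda>n. \<Prod>j<5. \<Prod>k<n. 1 - w ^ j * x * p ^ k) \<longlonglongrightarrow> (\<Prod>j<5. qpochhammer_inf (w ^ j * x) p)"
    by (intro tendsto_prod qpochhammer_inf_LIMSEQ assms)
  moreover have "(\<Prod>j<5. \<Prod>k<n. 1 - w ^ j * x * p ^ k) = (\<Prod>k<n. 1 - x ^ 5 * (p ^ 5) ^ k)" for n
  proof -
    have "(\<Prod>j<5. \<Prod>k<n. 1 - w ^ j * x * p ^ k) = (\<Prod>k<n. \<Prod>j<5. 1 - w ^ j * (x * p ^ k))"
      by (subst prod.swap) (simp add: mult.assoc)
    thus ?thesis
      unfolding prod_roots_of_unity_5[OF assms(1,2)]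
      by (simp add: power_mult_distrib mult.commute flip: power_mult)
  qed
  ultimately show ?thesis
    using qpochhammer_inf_LIMSEQ[OF p5, of "x ^ 5"] LIMSEQ_unique by force
qed

lemma root_of_unity_5_powers:
  fixes w :: complex
  assumes "w ^ 5 = 1" "w \<noteq> 1" "i < 4"
  shows "w ^ Suc i \<noteq> 1"
proof
  assume *: "w ^ Suc i = 1"
  consider "i = 0" | "i = 1" | "i = 2" | "i = 3" using assms(3) by linarith
  hence "w = 1"
  proof cases
    case 1
    thus ?thesis using * by simp
  next
    case 2
    hence "w\<^sup>2 = 1" using * by (simp add: numeral_2_eq_2)
    hence "w ^ 5 = w" by algebra
    thus ?thesis using assms(1) by simp
  next
    case 3
    hence "w ^ 3 = 1" using * by (simp add: numeral_3_eq_3)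
    hence "w * w ^ 5 = 1" by algebra
    thus ?thesis using assms(1) by simp
  next
    case 4
    hence "w ^ 4 = 1" using * by simp
    hence "w ^ 5 = w" by algebra
    thus ?thesis using assms(1) by simp
  qed
  with assms(2) show False by simp
qed

lemma norm_root_of_unity:
  fixes w :: complex
  assumes "w ^ n = 1" "n > 0"
  shows "norm w = 1"
proof -
  have "norm w ^ n = 1 ^ n"
    using assms(1) by (metis norm_one norm_power power_one)
  thus ?thesis
    using assms(2) by (intro power_eq_imp_eq_base[of "norm w" n 1]) auto
qed

text \<open>Each Euler product is split by exponents modulo 5. The class of multiples of 5 does not
  depend on \<open>j\<close> and gives a fifth power; in each other class the powers of
  \<open>w\<close> run through all fifth roots of unity, and the four results together with the
  factor of base \<open>q ^ 25\<close> form the sixth copy.\<close>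

lemma euler_prod_roots:
  assumes "w ^ 5 = 1" "w \<noteq> 1" "norm q < 1"
  shows "(\<Prod>j<5. qpochhammer_inf (w ^ j * q) (w ^ j * q)) * qpochhammer_inf (q ^ 25) (q ^ 25)
       = qpochhammer_inf (q ^ 5) (q ^ 5) ^ 6"
proof -
  have nw: "norm w = 1"
    using norm_root_of_unity[OF assms(1)] by simp
  have nwj: "norm (w ^ j * q) < 1" for j
    using assms nw by (simp add: norm_mult norm_power)
  have q5: "norm (q ^ 5) < 1"
    using assms norm_power_less_one by simp
  have last: "(\<Prod>i<5. g i) = g 4 * (\<Prod>i<4. g i)" for g :: "nat \<Rightarrow> complex"
    using prod.lessThan_Suc[of g 4] by (simp add: mult.commute)
  have wj5: "(w ^ j * q) ^ 5 = q ^ 5" for j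
    using assms(1) by (metis mult.commute mult_1 power_mult power_mult_distrib power_one)
  have 1: "(\<Prod>j<5. qpochhammer_inf ((w ^ Suc i) ^ j * q ^ Suc i) (q ^ 5)) = qpochhammer_inf (q ^ 5 * (q ^ 5) ^ i) ((q ^ 5) ^ 5)"
    if "i < 4" for i
  proof -
    have "(w ^ Suc i) ^ 5 = 1"
      using assms(1) by (metis mult.commute power_mult power_one)
    moreover have "(q ^ Suc i) ^ 5 = q ^ 5 * (q ^ 5) ^ i"
      by (simp add: power_mult_distrib mult.commute[of i] flip: power_mult)
    ultimately show ?thesis
      using qpochhammer_inf_prod_roots[OF _ root_of_unity_5_powers[OF assms(1,2) that] q5, of "q ^ Suc i"]
      by (simp only: simp_thms)
  qed
  have "(\<Prod>j<5. qpochhammer_inf (w ^ j * q) (w ^ j * q))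
      = (\<Prod>j<5. \<Prod>i<5. qpochhammer_inf ((w ^ j * q) * (w ^ j * q) ^ i) ((w ^ j * q) ^ 5))"
    by (intro prod.cong refl qpochhammer_inf_split nwj) auto
  also have "\<dots> = (\<Prod>i<5. \<Prod>j<5. qpochhammer_inf ((w ^ j * q) * (w ^ j * q) ^ i) ((w ^ j * q) ^ 5))"
    by (rule prod.swap)
  also have "\<dots> = (\<Prod>i<5. \<Prod>j<5. qpochhammer_inf ((w ^ Suc i) ^ j * q ^ Suc i) (q ^ 5))"
    unfolding wj5 power_Suc[symmetric]
    by (simp only: power_mult_distrib power_mult[symmetric] mult.commute)
  also have "\<dots> = (\<Prod>j<5. qpochhammer_inf ((w ^ 5) ^ j * q ^ 5) (q ^ 5))
        * (\<Prod>i<4. \<Prod>j<5. qpochhammer_inf ((w ^ Suc i) ^ j * q ^ Suc i) (q ^ 5))"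
    by (subst last) (simp del: power_Suc)
  also have "(\<Prod>j<5. qpochhammer_inf ((w ^ 5) ^ j * q ^ 5) (q ^ 5)) = qpochhammer_inf (q ^ 5) (q ^ 5) ^ 5"
    by (simp add: assms(1))
  also have "(\<Prod>i<4. \<Prod>j<5. qpochhammer_inf ((w ^ Suc i) ^ j * q ^ Suc i) (q ^ 5))
      = (\<Prod>i<4. qpochhammer_inf (q ^ 5 * (q ^ 5) ^ i) ((q ^ 5) ^ 5))"
    by (intro prod.cong refl 1) auto
  finally have 2: "(\<Prod>j<5. qpochhammer_inf (w ^ j * q) (w ^ j * q))
      = qpochhammer_inf (q ^ 5) (q ^ 5) ^ 5 * (\<Prod>i<4. qpochhammer_inf (q ^ 5 * (q ^ 5) ^ i) ((q ^ 5) ^ 5))" .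
  have "qpochhammer_inf (q ^ 5) (q ^ 5) = (\<Prod>i<5. qpochhammer_inf (q ^ 5 * (q ^ 5) ^ i) ((q ^ 5) ^ 5))"
    by (rule qpochhammer_inf_split[OF q5]) simp
  also have "\<dots> = qpochhammer_inf (q ^ 25) (q ^ 25) * (\<Prod>i<4. qpochhammer_inf (q ^ 5 * (q ^ 5) ^ i) ((q ^ 5) ^ 5))"
    by (subst last) (simp flip: power_mult power_add)
  finally have 3: "qpochhammer_inf (q ^ 5) (q ^ 5)
      = qpochhammer_inf (q ^ 25) (q ^ 25) * (\<Prod>i<4. qpochhammer_inf (q ^ 5 * (q ^ 5) ^ i) ((q ^ 5) ^ 5))" .
  show ?thesis
    unfolding 2 mult.assoc mult.commute[of "prod _ _"] 3[symmetric] by (simp add: eval_nat_numeral)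
qed

text \<open>1 - x - x^2 splits as (1 - a x)(1 - b x) with the golden ratio \<open>a\<close> and its
  conjugate \<open>b\<close>; the constant 11 is the Lucas number a^5 + b^5.\<close>

lemma prod_golden:
  fixes w t :: complex
  assumes "w ^ 5 = 1" "w \<noteq> 1"
  shows "(\<Prod>j<5. 1 - w ^ j * t - (w ^ j * t)\<^sup>2) = 1 - 11 * t ^ 5 - t ^ 10"
proof -
  define s where "s = complex_of_real (sqrt 5)"
  define a b where "a = (1 + s) / 2" and "b = (1 - s) / 2"
  have s2: "s\<^sup>2 = 5"
    unfolding s_def by (simp flip: of_real_power)
  have sum: "a + b = 1"
    by (simp add: a_def b_def field_simps)
  have "4 * (a * b) = 1 - s\<^sup>2"
    by (simp add: a_def b_def field_simps power2_eq_square)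
  hence ab: "a * b = -1"
    unfolding s2 by simp
  have "(\<Prod>j<5. 1 - w ^ j * t - (w ^ j * t)\<^sup>2) = (\<Prod>j<5. (1 - w ^ j * (a * t)) * (1 - w ^ j * (b * t)))"
  proof (intro prod.cong refl)
    fix j :: nat
    have "(1 - w ^ j * (a * t)) * (1 - w ^ j * (b * t))
        = 1 - (a + b) * (w ^ j * t) + (a * b) * (w ^ j * t)\<^sup>2"
      by algebra
    thus "1 - w ^ j * t - (w ^ j * t)\<^sup>2 = (1 - w ^ j * (a * t)) * (1 - w ^ j * (b * t))"
      unfolding sum ab by simp
  qed
  also have "\<dots> = (1 - (a * t) ^ 5) * (1 - (b * t) ^ 5)"
    unfolding prod.distrib prod_roots_of_unity_5[OF assms] ..
  also have "\<dots> = 1 - (a ^ 5 + b ^ 5) * t ^ 5 + (a * b) ^ 5 * t ^ 10"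
    by algebra
  also have "a ^ 5 + b ^ 5 = (a + b) ^ 5 - 5 * (a * b) * (a + b) ^ 3 + 5 * (a * b)\<^sup>2 * (a + b)"
    by algebra
  finally show ?thesis unfolding sum ab by simp
qed

lemma exists_root_of_unity_5: "\<exists>w :: complex. w ^ 5 = 1 \<and> w \<noteq> 1"
proof (intro exI conjI)
  show "cis (2 * pi / 5) ^ 5 = 1"
    by (subst Complex.DeMoivre) simp
  have "cos (2 * pi / 5) < cos 0"
    by (rule cos_monotone_0_pi) auto
  thus "cis (2 * pi / 5) \<noteq> 1"
    by (metis Re_complex_of_real cis.sel(1) cos_zero less_irrefl of_real_1)
qed

text \<open>The product of \<open>euler_dissection\<close> over the points \<open>w ^ j * q\<close>.
  Both \<open>R\<close> and the Euler product of base \<open>q ^ 25\<close> depend on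
  \<open>q ^ 5\<close> only, so they agree at all five points.\<close>

theorem euler_sixth_power:
  assumes "q \<noteq> 0" "norm q < 1"
  defines "R \<equiv> rogers_ramanujan_R (q ^ 5)"
  shows "qpochhammer_inf (q ^ 5) (q ^ 5) ^ 6 * R ^ 5
       = qpochhammer_inf (q ^ 25) (q ^ 25) ^ 6 * (1 - 11 * (q * R) ^ 5 - (q * R) ^ 10)"
proof -
  obtain w :: complex where w: "w ^ 5 = 1" "w \<noteq> 1"
    using exists_root_of_unity_5 by blast
  let ?E = "qpochhammer_inf (q ^ 25) (q ^ 25)"
  have R0: "R \<noteq> 0"
    unfolding R_def rogers_ramanujan_R_eq
    using rr_num_nonzero rr_den_nonzero norm_power_less_one[OF assms(2), of 5] by simp
  have nw: "norm w = 1" "w \<noteq> 0"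
    using norm_root_of_unity[OF w(1)] w(1) by auto
  have factor: "qpochhammer_inf (w ^ j * q) (w ^ j * q) * R = ?E * (1 - w ^ j * (q * R) - (w ^ j * (q * R))\<^sup>2)" for j
  proof -
    have 5: "(w ^ j * q) ^ 5 = q ^ 5"
      using w(1) by (metis mult.commute mult_1 power_mult power_mult_distrib power_one)
    have "(w ^ j * q) ^ 25 = ((w ^ j * q) ^ 5) ^ 5"
      by (simp flip: power_mult)
    also have "\<dots> = q ^ 25"
      unfolding 5 by (simp flip: power_mult)
    finally have 25: "(w ^ j * q) ^ 25 = q ^ 25" .
    have "qpochhammer_inf (w ^ j * q) (w ^ j * q) = ?E * (1 / R - w ^ j * q - (w ^ j * q)\<^sup>2 * R)"
      using euler_dissection[of "w ^ j * q"] assms nw unfolding 5 25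
      by (simp add: norm_mult norm_power)
    thus ?thesis
      using R0 by (simp add: field_simps power2_eq_square)
  qed
  have "(\<Prod>j<5. qpochhammer_inf (w ^ j * q) (w ^ j * q)) * R ^ 5
      = (\<Prod>j<5. qpochhammer_inf (w ^ j * q) (w ^ j * q) * R)"
    by (simp add: prod.distrib)
  also have "\<dots> = ?E ^ 5 * (1 - 11 * (q * R) ^ 5 - (q * R) ^ 10)"
    unfolding factor prod.distrib prod_golden[OF w] by simp
  finally have "(\<Prod>j<5. qpochhammer_inf (w ^ j * q) (w ^ j * q)) * ?E * R ^ 5
      = ?E ^ 6 * (1 - 11 * (q * R) ^ 5 - (q * R) ^ 10)"
    by (simp add: eval_nat_numeral mult_ac)
  thus ?thesis
    unfolding euler_prod_roots[OF w assms(2)] .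
qed

text \<open>The same identity one level down, taken at a fifth root of \<open>q\<close>.\<close>

lemma euler_sixth_power':
  assumes "q \<noteq> 0" "norm q < 1"
  defines "R \<equiv> rogers_ramanujan_R q"
  shows "qpochhammer_inf q q ^ 6 * R ^ 5
       = qpochhammer_inf (q ^ 5) (q ^ 5) ^ 6 * (1 - 11 * (q * R ^ 5) - (q * R ^ 5)\<^sup>2)"
proof -
  define p where "p = exp (Ln q / 5)"
  have p5: "p ^ 5 = q"
    using assms by (simp add: p_def flip: exp_of_nat_mult)
  have "norm p < 1"
  proof (rule ccontr)
    assume "\<not> norm p < 1"
    hence "norm (p ^ 5) \<ge> 1" by (simp add: norm_power)
    thus False using p5 assms by simp
  qed
  moreover have "p \<noteq> 0" using p5 assms by auto
  moreover have "p ^ 25 = q ^ 5" "(p * R) ^ 5 = q * R ^ 5" "(p * R) ^ 10 = (q * R ^ 5)\<^sup>2"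
    by (simp_all add: p5[symmetric] power_mult_distrib flip: power_mult)
  ultimately show ?thesis
    using euler_sixth_power[of p] unfolding p5 R_def by simp
qed

text \<open>Eliminating the three Euler products from \<open>h1\<close>, \<open>h2\<close> and
  \<open>h3\<close> leaves a quadratic in \<open>U\<close> over the rational functions of
  \<open>v\<close>. Its two roots are v P / Q and -Q / (v P); the choice between them is made later,
  near \<open>q = 0\<close>.\<close>

theorem rogers_ramanujan_modular_equation:
  assumes "q \<noteq> 0" "norm q < 1"
  defines "U \<equiv> q * rogers_ramanujan_R q ^ 5" and "v \<equiv> q * rogers_ramanujan_R (q ^ 5)"
  defines "P \<equiv> 1 - 2 * v + 4 * v ^ 2 - 3 * v ^ 3 + v ^ 4"
      and "Q \<equiv> 1 + 3 * v + 4 * v ^ 2 + 2 * v ^ 3 + v ^ 4"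
  shows "(U * Q - v * P) * (U * v * P + Q) = 0"
proof -
  define R S where "R = rogers_ramanujan_R q" and "S = rogers_ramanujan_R (q ^ 5)"
  define e1 e5 e25 where "e1 = qpochhammer_inf q q" and "e5 = qpochhammer_inf (q ^ 5) (q ^ 5)"
    and "e25 = qpochhammer_inf (q ^ 25) (q ^ 25)"
  have pw: "norm (q ^ k) < 1" if "k > 0" for k
    using assms(2) that by (rule norm_power_less_one)
  have e0: "e1 \<noteq> 0" "e25 \<noteq> 0"
    unfolding e1_def e25_def by (intro qpochhammer_inf_nonzero assms pw; simp)+
  have S0: "S \<noteq> 0"
    unfolding S_def rogers_ramanujan_R_eq using rr_num_nonzero rr_den_nonzero pw[of 5] by simp
  define d where "d = 1 - v - v\<^sup>2"
  have h1: "e1 * S = e25 * d"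
    unfolding d_def v_def e1_def e25_def S_def[symmetric] euler_dissection[OF assms(1,2)]
    using S0 by (simp add: field_simps power2_eq_square)
  have h2: "e5 ^ 6 * S ^ 5 = e25 ^ 6 * (1 - 11 * v ^ 5 - v ^ 10)"
    using euler_sixth_power[OF assms(1,2)] by (simp add: e5_def e25_def S_def v_def)
  have h3: "e1 ^ 6 * R ^ 5 = e5 ^ 6 * (1 - 11 * U - U\<^sup>2)"
    using euler_sixth_power'[OF assms(1,2)] by (simp add: e1_def e5_def R_def U_def)
  have d0: "d \<noteq> 0"
    using h1 e0 S0 by auto
  have fac: "1 - 11 * v ^ 5 - v ^ 10 = d * (P * Q)"
    unfolding P_def Q_def d_def by algebra
  \<comment> \<open>Makes the quadratic factor: its linear coefficient
    \<open>d ^ 5 + 11 * v * P * Q\<close> becomes the difference of the squares of \<open>Q\<close>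
    and \<open>v * P\<close>.\<close>
  have key: "Q\<^sup>2 - 11 * v * P * Q - v\<^sup>2 * P\<^sup>2 = d ^ 5"
    unfolding P_def Q_def d_def by algebra
  have "e25 ^ 6 * d ^ 6 * U = (e1 * S) ^ 6 * (q * R ^ 5)"
    unfolding h1 U_def R_def by (simp add: power_mult_distrib)
  also have "\<dots> = (e1 ^ 6 * R ^ 5) * (q * S ^ 6)"
    by (simp add: power_mult_distrib mult_ac)
  also have "\<dots> = (e5 ^ 6 * S ^ 5) * (q * S) * (1 - 11 * U - U\<^sup>2)"
    unfolding h3 by (simp add: eval_nat_numeral mult_ac)
  also have "\<dots> = e25 ^ 6 * (d * (P * Q)) * v * (1 - 11 * U - U\<^sup>2)"
    using h2 fac by (simp add: v_def S_def)
  finally have "(e25 ^ 6 * d) * (d ^ 5 * U) = (e25 ^ 6 * d) * (P * Q * v * (1 - 11 * U - U\<^sup>2))"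
    by (simp add: eval_nat_numeral mult_ac)
  hence "d ^ 5 * U = P * Q * v * (1 - 11 * U - U\<^sup>2)"
    using e0 d0 by simp
  thus ?thesis
    unfolding key[symmetric] by algebra
qed

section \<open>Power series of the reciprocal products\<close>

unbundle no vec_syntax
unbundle fps_syntax

definition nonneg_fps :: "real fps \<Rightarrow> bool" where
  "nonneg_fps f \<longleftrightarrow> (\<forall>n. f $ n \<ge> 0)"

lemma nonneg_fps_add: "nonneg_fps f \<Longrightarrow> nonneg_fps g \<Longrightarrow> nonneg_fps (f + g)"
  by (simp add: nonneg_fps_def)

lemma nonneg_fps_mult: "nonneg_fps f \<Longrightarrow> nonneg_fps g \<Longrightarrow> nonneg_fps (f * g)"
  by (auto simp: nonneg_fps_def fps_mult_nth intro!: sum_nonneg mult_nonneg_nonneg)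

lemma nonneg_fps_numeral: "nonneg_fps (numeral k)"
  by (auto simp: nonneg_fps_def fps_numeral_nth)

lemma nonneg_fps_one: "nonneg_fps 1"
  by (simp add: nonneg_fps_def)

lemma nonneg_fps_X: "nonneg_fps fps_X"
  by (simp add: nonneg_fps_def fps_X_def)

lemma nonneg_fps_power: "nonneg_fps f \<Longrightarrow> nonneg_fps (f ^ n)"
  by (induction n) (auto intro: nonneg_fps_one nonneg_fps_mult)

lemma nonneg_fps_prod: "(\<And>i. i \<in> A \<Longrightarrow> nonneg_fps (f i)) \<Longrightarrow> nonneg_fps (\<Prod>i\<in>A. f i)"
  by (induction A rule: infinite_finite_induct) (auto intro: nonneg_fps_one nonneg_fps_mult)

lemmas nonneg_fps_intros = nonneg_fps_add nonneg_fps_mult nonneg_fps_numeral nonneg_fps_one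
  nonneg_fps_X nonneg_fps_power nonneg_fps_prod

section \<open>Truncated products of geometric series and their coefficientwise limits\<close>

definition fps_geom :: "nat \<Rightarrow> real fps" where
  "fps_geom m = Abs_fps (\<lambda>n. if m dvd n then 1 else 0)"

lemma nonneg_fps_geom: "nonneg_fps (fps_geom m)"
  by (simp add: nonneg_fps_def fps_geom_def)

lemma fps_geom_nth_0 [simp]: "fps_geom m $ 0 = 1"
  by (simp add: fps_geom_def)

lemma fps_geom_mult:
  assumes "m > 0"
  shows "fps_geom m * (1 - fps_X ^ m) = 1"
proof (rule fps_ext)
  fix n
  have "(fps_geom m * (1 - fps_X ^ m)) $ n = fps_geom m $ n - (fps_geom m * fps_X ^ m) $ n"
    by (simp add: algebra_simps)
  also have "\<dots> = (if m dvd n then 1 else 0) - (if n < m then 0 else if m dvd (n - m) then 1 else 0)"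
    by (simp add: fps_X_power_mult_right_nth fps_geom_def)
  also have "\<dots> = (1 :: real fps) $ n"
    using assms by (auto simp: dvd_minus_self dest: dvd_imp_le)
  finally show "(fps_geom m * (1 - fps_X ^ m)) $ n = 1 $ n" .
qed

definition fps_qinv :: "nat \<Rightarrow> nat \<Rightarrow> real fps" where
  "fps_qinv a N = (\<Prod>k<N. fps_geom (a + 5 * k))"

text \<open>The diagonal is the coefficientwise limit for \<open>a > 0\<close>: later factors start
  beyond degree \<open>n\<close>, so coefficient \<open>n\<close> is final from the truncation of
  length \<open>n\<close> on.\<close>

definition fps_qinv_inf :: "nat \<Rightarrow> real fps" where
  "fps_qinv_inf a = Abs_fps (\<lambda>n. fps_qinv a n $ n)"

lemma nonneg_fps_qinv: "nonneg_fps (fps_qinv a N)"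
  unfolding fps_qinv_def by (intro nonneg_fps_prod nonneg_fps_geom)

lemma nonneg_fps_qinv_inf: "nonneg_fps (fps_qinv_inf a)"
  using nonneg_fps_qinv by (simp add: nonneg_fps_def fps_qinv_inf_def)

lemma fps_qinv_Suc_nth:
  assumes "n < a + 5 * N"
  shows "fps_qinv a (Suc N) $ n = fps_qinv a N $ n"
proof -
  have "fps_qinv a (Suc N) $ n = (\<Sum>i=0..n. fps_qinv a N $ i * fps_geom (a + 5 * N) $ (n - i))"
    by (simp add: fps_qinv_def fps_mult_nth)
  also have "\<dots> = (\<Sum>i=0..n. if i = n then fps_qinv a N $ n else 0)"
    using assms by (intro sum.cong) (auto simp: fps_geom_def dest!: dvd_imp_le)
  finally show ?thesis by simp
qed

lemma fps_qinv_nth: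
  assumes "a > 0" "n \<le> N"
  shows "fps_qinv a N $ n = fps_qinv_inf a $ n"
  using assms(2)
proof (induction N rule: dec_induct)
  case (step N)
  thus ?case using assms(1) by (subst fps_qinv_Suc_nth) auto
qed (simp add: fps_qinv_inf_def)

lemma fps_qinv_mono: "fps_qinv a N $ n \<le> fps_qinv a (Suc N) $ n"
proof -
  have "fps_qinv a N $ n = (\<Sum>i\<in>{n}. fps_qinv a N $ i * fps_geom (a + 5 * N) $ (n - i))"
    by simp
  also have "\<dots> \<le> (\<Sum>i=0..n. fps_qinv a N $ i * fps_geom (a + 5 * N) $ (n - i))"
    using nonneg_fps_qinv[of a N] nonneg_fps_geom[of "a + 5 * N"]
    by (intro sum_mono2) (auto simp: nonneg_fps_def)
  also have "\<dots> = fps_qinv a (Suc N) $ n"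
    by (simp add: fps_qinv_def fps_mult_nth)
  finally show ?thesis .
qed

lemma fps_qinv_le:
  assumes "a > 0"
  shows "fps_qinv a N $ n \<le> fps_qinv_inf a $ n"
proof -
  have "fps_qinv a N $ n \<le> fps_qinv a (max N n) $ n"
    using lift_Suc_mono_le[of "\<lambda>N. fps_qinv a N $ n"] fps_qinv_mono by force
  thus ?thesis using fps_qinv_nth[OF assms, of n "max N n"] by simp
qed

section \<open>Real power series that converge to a function on the whole unit disc\<close>

definition fps_sums_to :: "real fps \<Rightarrow> (complex \<Rightarrow> complex) \<Rightarrow> bool" where
  "fps_sums_to f F \<longleftrightarrow> (\<forall>q. norm q < 1 \<longrightarrow> (\<lambda>n. of_real (f $ n) * q ^ n) sums F q)"

lemma fps_sums_toD: "fps_sums_to f F \<Longrightarrow> norm q < 1 \<Longrightarrow> (\<lambda>n. of_real (f $ n) * q ^ n) sums F q"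
  by (simp add: fps_sums_to_def)

text \<open>Convergence at a real point strictly between \<open>norm q\<close> and 1 forces absolute
  convergence at \<open>q\<close>.\<close>

lemma fps_sums_to_abs_summable:
  fixes q :: complex
  assumes "fps_sums_to f F" "norm q < 1"
  shows "summable (\<lambda>n. norm (of_real (f $ n) * q ^ n))"
proof -
  obtain r where r: "norm q < r" "r < 1" using assms(2) dense by blast
  hence r': "norm (complex_of_real r) = r" by (simp add: order_less_le_trans[OF _ r(1)[THEN less_imp_le]])
       (use r norm_ge_zero[of q] in linarith)
  have "summable (\<lambda>n. of_real (f $ n) * complex_of_real r ^ n)"
    using fps_sums_toD[OF assms(1), of "of_real r"] r r' by (simp add: sums_iff)
  thus ?thesis
    by (rule powser_insidea) (use r r' in simp)
qed

lemma fps_sums_to_mult: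
  assumes "fps_sums_to f F" "fps_sums_to g G"
  shows "fps_sums_to (f * g) (\<lambda>q. F q * G q)"
  unfolding fps_sums_to_def
proof (intro allI impI)
  fix q :: complex assume q: "norm q < 1"
  have "(\<lambda>n. \<Sum>i\<le>n. (of_real (f $ i) * q ^ i) * (of_real (g $ (n - i)) * q ^ (n - i))) sums
      ((\<Sum>n. of_real (f $ n) * q ^ n) * (\<Sum>n. of_real (g $ n) * q ^ n))"
    by (intro Cauchy_product_sums fps_sums_to_abs_summable[OF assms(1) q] fps_sums_to_abs_summable[OF assms(2) q])
  moreover have "(\<Sum>n. of_real (f $ n) * q ^ n) = F q" "(\<Sum>n. of_real (g $ n) * q ^ n) = G q"
    using fps_sums_toD[OF assms(1) q] fps_sums_toD[OF assms(2) q] by (simp_all add: sums_iff)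
  moreover have "(\<Sum>i\<le>n. (of_real (f $ i) * q ^ i) * (of_real (g $ (n - i)) * q ^ (n - i)))
      = of_real ((f * g) $ n) * q ^ n" for n
  proof -
    have eq: "(of_real (f $ i) * q ^ i) * (of_real (g $ (n - i)) * q ^ (n - i))
        = of_real (f $ i * g $ (n - i)) * q ^ n" if "i \<le> n" for i
      using that by (simp add: mult_ac flip: power_add)
    show ?thesis
      unfolding fps_mult_nth of_real_sum sum_distrib_right atLeast0AtMost
      by (rule sum.cong[OF refl]) (simp only: eq atMost_iff)
  qed
  ultimately show "(\<lambda>n. of_real ((f * g) $ n) * q ^ n) sums (F q * G q)"
    by simp
qed

lemma fps_sums_to_add:
  assumes "fps_sums_to f F" "fps_sums_to g G"
  shows "fps_sums_to (f + g) (\<lambda>q. F q + G q)"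
  using assms by (auto simp: fps_sums_to_def algebra_simps intro!: sums_add)

lemma fps_sums_to_const: "fps_sums_to (fps_const c) (\<lambda>_. of_real c)"
  unfolding fps_sums_to_def
proof (intro allI impI)
  fix q :: complex
  have "(\<lambda>n. if n = 0 then of_real c else 0) sums (of_real c :: complex)"
    by (rule sums_single)
  moreover have "(if n = 0 then of_real c else 0) = of_real (fps_const c $ n) * q ^ n" for n
    by simp
  ultimately show "(\<lambda>n. of_real (fps_const c $ n) * q ^ n) sums of_real c"
    by simp
qed

lemma fps_sums_to_X: "fps_sums_to fps_X (\<lambda>q. q)"
  unfolding fps_sums_to_def
proof (intro allI impI)
  fix q :: complex
  have "(\<lambda>n. if n = 1 then q else 0) sums q"
    by (rule sums_single)
  moreover have "(if n = 1 then q else 0) = of_real (fps_X $ n) * q ^ n" for n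
    by (simp add: fps_X_def)
  ultimately show "(\<lambda>n. of_real (fps_X $ n) * q ^ n) sums q"
    by simp
qed

lemma fps_sums_to_one: "fps_sums_to 1 (\<lambda>_. 1)"
  using fps_sums_to_const[of 1] by simp

lemma fps_sums_to_power: "fps_sums_to f F \<Longrightarrow> fps_sums_to (f ^ n) (\<lambda>q. F q ^ n)"
  by (induction n) (auto intro: fps_sums_to_one fps_sums_to_mult)

lemma fps_sums_to_prod:
  "(\<And>i. i \<in> A \<Longrightarrow> fps_sums_to (f i) (F i)) \<Longrightarrow> fps_sums_to (\<Prod>i\<in>A. f i) (\<lambda>q. \<Prod>i\<in>A. F i q)"
  by (induction A rule: infinite_finite_induct) (auto intro: fps_sums_to_one fps_sums_to_mult)

lemma fps_sums_to_sum:
  "(\<And>i. i \<in> A \<Longrightarrow> fps_sums_to (f i) (F i)) \<Longrightarrow> fps_sums_to (\<Sum>i\<in>A. f i) (\<lambda>q. \<Sum>i\<in>A. F i q)"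
proof (induction A rule: infinite_finite_induct)
  case (infinite A)
  thus ?case using fps_sums_to_const[of 0] by simp
next
  case empty
  thus ?case using fps_sums_to_const[of 0] by simp
qed (auto intro: fps_sums_to_add)

definition fps_stretch :: "nat \<Rightarrow> real fps \<Rightarrow> real fps" where
  "fps_stretch m f = Abs_fps (\<lambda>n. if m dvd n then f $ (n div m) else 0)"

lemma fps_sums_to_stretch:
  assumes "fps_sums_to f F" "m > 0"
  shows "fps_sums_to (fps_stretch m f) (\<lambda>q. F (q ^ m))"
  unfolding fps_sums_to_def
proof (intro allI impI)
  fix q :: complex assume q: "norm q < 1"
  have "(\<lambda>n. of_real (f $ n) * (q ^ m) ^ n) sums F (q ^ m)"
    by (rule fps_sums_toD[OF assms(1) norm_power_less_one[OF q assms(2)]])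
  moreover have "of_real (f $ n) * (q ^ m) ^ n = of_real (fps_stretch m f $ (m * n)) * q ^ (m * n)" for n
    using assms(2) by (simp add: fps_stretch_def power_mult)
  ultimately have "(\<lambda>n. of_real (fps_stretch m f $ (m * n)) * q ^ (m * n)) sums F (q ^ m)"
    by simp
  thus "(\<lambda>n. of_real (fps_stretch m f $ n) * q ^ n) sums F (q ^ m)"
    by (subst (asm) sums_mono_reindex[where g = "\<lambda>n. m * n"])
       (use assms(2) in \<open>auto simp: strict_mono_def fps_stretch_def\<close>)
qed

lemma fps_geom_eq_stretch: "fps_geom m = fps_stretch m (Abs_fps (\<lambda>_. 1))"
  by (simp add: fps_geom_def fps_stretch_def fps_eq_iff)

lemma fps_sums_to_geom:
  assumes "m > 0"
  shows "fps_sums_to (fps_geom m) (\<lambda>q. 1 / (1 - q ^ m))"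
proof -
  have "fps_sums_to (Abs_fps (\<lambda>_. 1)) (\<lambda>q. 1 / (1 - q))"
    by (auto simp: fps_sums_to_def intro: geometric_sums)
  thus ?thesis
    unfolding fps_geom_eq_stretch using assms by (rule fps_sums_to_stretch)
qed

text \<open>The truncations converge on the disc to the finite reciprocal products. Their
  coefficients are dominated by those of the limit series, so Tannery's theorem applies as soon as
  the limit series converges at real points below 1.\<close>

lemma fps_sums_to_qinv_inf:
  assumes "a > 0"
  shows "fps_sums_to (fps_qinv_inf a) (\<lambda>q. 1 / qpochhammer_inf (q ^ a) (q ^ 5))"
proof -
  have fin: "fps_sums_to (fps_qinv a N) (\<lambda>q. 1 / (\<Prod>k<N. 1 - q ^ a * (q ^ 5) ^ k))" for N
  proof -
    have "fps_sums_to (fps_qinv a N) (\<lambda>q. \<Prod>k<N. 1 / (1 - q ^ (a + 5 * k)))"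
      unfolding fps_qinv_def using assms by (intro fps_sums_to_prod fps_sums_to_geom) auto
    thus ?thesis
      by (simp add: prod_dividef power_add power_mult)
  qed
  have lim: "(\<lambda>N. 1 / (\<Prod>k<N. 1 - q ^ a * (q ^ 5) ^ k)) \<longlonglongrightarrow> 1 / qpochhammer_inf (q ^ a) (q ^ 5)"
    if "norm q < 1" for q
    using norm_power_less_one[OF that] assms
    by (intro tendsto_intros qpochhammer_inf_LIMSEQ qpochhammer_inf_nonzero) auto
  have nn: "fps_qinv a N $ n \<ge> 0" "fps_qinv_inf a $ n \<ge> 0" for N n
    using nonneg_fps_qinv nonneg_fps_qinv_inf by (simp_all add: nonneg_fps_def)
  have sm: "summable (\<lambda>n. fps_qinv_inf a $ n * r ^ n)" if r: "0 \<le> r" "r < 1" for r :: real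
  proof -
    have nr: "norm (complex_of_real r) < 1" using r by simp
    have "Bseq (\<lambda>N. 1 / (\<Prod>k<N. 1 - complex_of_real r ^ a * (complex_of_real r ^ 5) ^ k))"
      using lim[OF nr] convergent_imp_Bseq convergent_def by blast
    then obtain K where K: "\<And>N. norm (1 / (\<Prod>k<N. 1 - complex_of_real r ^ a * (complex_of_real r ^ 5) ^ k)) \<le> K"
      by (auto simp: Bseq_def)
    show ?thesis
    proof (rule summableI_nonneg_bounded)
      fix M
      have s: "(\<lambda>n. complex_of_real (fps_qinv a M $ n * r ^ n)) sums
          (1 / (\<Prod>k<M. 1 - complex_of_real r ^ a * (complex_of_real r ^ 5) ^ k))"
        using fps_sums_toD[OF fin[of M] nr] by simp
      hence sr: "(\<lambda>n. fps_qinv a M $ n * r ^ n) sums Re (1 / (\<Prod>k<M. 1 - complex_of_real r ^ a * (complex_of_real r ^ 5) ^ k))"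
        using sums_Re by fastforce
      \<comment> \<open>Below degree \<open>M\<close> the limit series agrees with the truncation of
        length \<open>M\<close>, whose value at \<open>r\<close> is bounded by \<open>K\<close>
        independently of \<open>M\<close>.\<close>
      have "(\<Sum>n<M. fps_qinv_inf a $ n * r ^ n) = (\<Sum>n<M. fps_qinv a M $ n * r ^ n)"
        using assms by (intro sum.cong) (auto simp: fps_qinv_nth)
      also have "\<dots> \<le> Re (1 / (\<Prod>k<M. 1 - complex_of_real r ^ a * (complex_of_real r ^ 5) ^ k))"
        unfolding sums_unique[OF sr] using nn r
        by (intro sum_le_suminf sums_summable[OF sr]) auto
      also have "\<dots> \<le> K"
        using complex_Re_le_cmod K order_trans by blast
      finally show "(\<Sum>n<M. fps_qinv_inf a $ n * r ^ n) \<le> K" .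
    qed (use nn r in auto)
  qed
  show ?thesis
    unfolding fps_sums_to_def
  proof (intro allI impI)
    fix q :: complex assume q: "norm q < 1"
    have bnd: "norm (of_real (fps_qinv a N $ n) * q ^ n) \<le> fps_qinv_inf a $ n * norm q ^ n" for N n
      using nn fps_qinv_le[OF assms, of N n]
      by (auto simp: norm_mult norm_power intro!: mult_right_mono)
    have T: "summable (\<lambda>n. norm (of_real (fps_qinv_inf a $ n) * q ^ n)) \<and>
       ((\<lambda>N. \<Sum>n. of_real (fps_qinv a N $ n) * q ^ n) \<longlonglongrightarrow> (\<Sum>n. of_real (fps_qinv_inf a $ n) * q ^ n))"
    proof (rule tannerys_theorem[THEN conjunct2])
      show "(\<lambda>N. of_real (fps_qinv a N $ n) * q ^ n) \<longlonglongrightarrow> of_real (fps_qinv_inf a $ n) * q ^ n" for n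
      proof (rule tendsto_eventually)
        show "\<forall>\<^sub>F N in sequentially. of_real (fps_qinv a N $ n) * q ^ n = of_real (fps_qinv_inf a $ n) * q ^ n"
          using eventually_ge_at_top[of n] by eventually_elim (simp add: fps_qinv_nth[OF assms])
      qed
      show "\<forall>\<^sub>F (n, N) in sequentially \<times>\<^sub>F sequentially.
          norm (of_real (fps_qinv a N $ n) * q ^ n) \<le> fps_qinv_inf a $ n * norm q ^ n"
        by (intro always_eventually) (use bnd in auto)
      show "summable (\<lambda>n. fps_qinv_inf a $ n * norm q ^ n)"
        by (rule sm) (use q in auto)
    qed auto
    have "(\<Sum>n. of_real (fps_qinv a N $ n) * q ^ n) = 1 / (\<Prod>k<N. 1 - q ^ a * (q ^ 5) ^ k)" for N
      using fps_sums_toD[OF fin q] by (simp add: sums_iff)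
    with T lim[OF q] have "(\<Sum>n. of_real (fps_qinv_inf a $ n) * q ^ n) = 1 / qpochhammer_inf (q ^ a) (q ^ 5)"
      using LIMSEQ_unique by force
    thus "(\<lambda>n. of_real (fps_qinv_inf a $ n) * q ^ n) sums (1 / qpochhammer_inf (q ^ a) (q ^ 5))"
      using summable_norm_cancel T by (metis sums_iff)
  qed
qed

section \<open>Nonnegativity\<close>

definition rr_coeff_G :: "real fps" where
  "rr_coeff_G = fps_qinv_inf 1 * fps_qinv_inf 4"

definition rr_coeff_H :: "real fps" where
  "rr_coeff_H = fps_qinv_inf 2 * fps_qinv_inf 3"

lemma fps_sums_to_G: "fps_sums_to rr_coeff_G (\<lambda>q. 1 / rr_num q)"
  using fps_sums_to_mult[OF fps_sums_to_qinv_inf[of 1] fps_sums_to_qinv_inf[of 4]]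
  by (simp add: rr_coeff_G_def rr_num_def)

lemma fps_sums_to_H: "fps_sums_to rr_coeff_H (\<lambda>q. 1 / rr_den q)"
  using fps_sums_to_mult[OF fps_sums_to_qinv_inf[of 2] fps_sums_to_qinv_inf[of 3]]
  by (simp add: rr_coeff_H_def rr_den_def)

lemma nonneg_G: "nonneg_fps rr_coeff_G" and nonneg_H: "nonneg_fps rr_coeff_H"
  unfolding rr_coeff_G_def rr_coeff_H_def by (intro nonneg_fps_mult nonneg_fps_qinv_inf)+

lemma G_nth_0: "rr_coeff_G $ 0 = 1" and H_nth_0: "rr_coeff_H $ 0 = 1"
  by (simp_all add: rr_coeff_G_def rr_coeff_H_def fps_qinv_inf_def fps_qinv_def)

lemma fps_mult_nth_ge:
  assumes "nonneg_fps f" "nonneg_fps g"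
  shows "f $ n * g $ 0 \<le> (f * g) $ n"
proof -
  have "(\<Sum>i\<in>{n}. f $ i * g $ (n - i)) \<le> (\<Sum>i=0..n. f $ i * g $ (n - i))"
    using assms by (intro sum_mono2) (auto simp: nonneg_fps_def)
  thus ?thesis by (simp add: fps_mult_nth)
qed

text \<open>The factor 1/(1 - X) already has all coefficients 1. This is the source of all strict
  inequalities at the end.\<close>

lemma G_pos: "rr_coeff_G $ n > 0"
proof -
  have "fps_qinv 1 1 $ n \<le> fps_qinv_inf 1 $ n"
    by (rule fps_qinv_le) simp
  moreover have "fps_qinv 1 1 $ n = 1"
    by (simp add: fps_qinv_def fps_geom_def)
  ultimately have "0 < fps_qinv_inf 1 $ n * fps_qinv_inf 4 $ 0"
    by (simp add: fps_qinv_inf_def[of 4] fps_qinv_def)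
  also have "\<dots> \<le> rr_coeff_G $ n"
    unfolding rr_coeff_G_def by (intro fps_mult_nth_ge nonneg_fps_qinv_inf)
  finally show ?thesis .
qed

lemma G_mult_pos:
  assumes "nonneg_fps f" "f $ 0 > 0"
  shows "(rr_coeff_G * f) $ n > 0"
  using G_pos[of n] assms fps_mult_nth_ge[OF nonneg_G assms(1), of n]
  by (smt (verit) mult_pos_pos)

text \<open>Over the common denominator, with T = X^(5k), the numerator is T (X - X^2 - X^3 + X^4) =
  T X (1 - X)(1 - X^2).\<close>

lemma geom_pair_diff:
  "fps_geom (1 + 5 * k) * fps_geom (4 + 5 * k) - fps_geom (2 + 5 * k) * fps_geom (3 + 5 * k)
   = fps_X ^ (1 + 5 * k) * (1 - fps_X) * (1 - fps_X\<^sup>2)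
     * (fps_geom (1 + 5 * k) * fps_geom (4 + 5 * k)) * (fps_geom (2 + 5 * k) * fps_geom (3 + 5 * k))"
proof -
  define T where "T = (fps_X :: real fps) ^ (5 * k)"
  have g: "fps_geom (i + 5 * k) * (1 - T * fps_X ^ i) = 1" if "i > 0" for i
    using fps_geom_mult[of "i + 5 * k"] that by (simp add: T_def power_add mult.commute)
  show ?thesis
    using g[of 1] g[of 2] g[of 3] g[of 4] unfolding power_add T_def[symmetric] power_one_right
    by simp algebra
qed

text \<open>The only factors with negative coefficients are (1 - X)(1 - X^2), and 1/(1 - X)^2
  reduces them to 1 + X.\<close>

lemma nonneg_geom_pair_diff:
  "nonneg_fps (fps_geom 1 ^ 2 * (fps_geom (1 + 5 * k) * fps_geom (4 + 5 * k)
                               - fps_geom (2 + 5 * k) * fps_geom (3 + 5 * k)))"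
proof -
  have "fps_geom 1 * (1 - fps_X) = 1"
    using fps_geom_mult[of 1] by simp
  hence "fps_geom 1 ^ 2 * ((1 - fps_X) * (1 - fps_X\<^sup>2)) = 1 + fps_X"
    by algebra
  moreover have "fps_geom 1 ^ 2 * (fps_X ^ (1 + 5 * k) * (1 - fps_X) * (1 - fps_X\<^sup>2) * a * b)
      = (fps_geom 1 ^ 2 * ((1 - fps_X) * (1 - fps_X\<^sup>2))) * fps_X ^ (1 + 5 * k) * a * b" for a b
    by (simp only: mult_ac)
  ultimately have "fps_geom 1 ^ 2 * (fps_X ^ (1 + 5 * k) * (1 - fps_X) * (1 - fps_X\<^sup>2) * a * b)
      = (1 + fps_X) * fps_X ^ (1 + 5 * k) * a * b" for a b
    by simp
  thus ?thesis
    unfolding geom_pair_diff by (simp only:) (intro nonneg_fps_intros nonneg_fps_geom)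
qed

text \<open>Exchanges one factor at a time: ac - bd = (a - b) c + b (c - d). The single
  \<open>u\<close> serves both differences.\<close>

lemma nonneg_fps_diff_mult:
  assumes "nonneg_fps (u * (a - b))" "nonneg_fps (u * (c - d))" "nonneg_fps b" "nonneg_fps c"
  shows "nonneg_fps (u * (a * c - b * d))"
proof -
  have "u * (a * c - b * d) = u * (a - b) * c + b * (u * (c - d))"
    by (simp add: algebra_simps)
  thus ?thesis using assms by (auto intro: nonneg_fps_intros)
qed

lemma nonneg_fps_diff_prod:
  assumes "\<And>i. i \<in> A \<Longrightarrow> nonneg_fps (u * (f i - g i))"
    and "\<And>i. i \<in> A \<Longrightarrow> nonneg_fps (f i)" "\<And>i. i \<in> A \<Longrightarrow> nonneg_fps (g i)"
  shows "nonneg_fps (u * ((\<Prod>i\<in>A. f i) - (\<Prod>i\<in>A. g i)))"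
  using assms
proof (induction A rule: infinite_finite_induct)
  case (insert x A)
  thus ?case
    by (auto intro!: nonneg_fps_diff_mult nonneg_fps_prod)
qed (auto simp: nonneg_fps_def)

lemma nonneg_fps_diff_power:
  assumes "nonneg_fps (u * (a - b))" "nonneg_fps a" "nonneg_fps b"
  shows "nonneg_fps (u * (a ^ n - b ^ n))"
  using nonneg_fps_diff_prod[of "{..<n}" u "\<lambda>_. a" "\<lambda>_. b"] assms by simp

text \<open>By \<open>geom_pair_diff\<close> the pair \<open>g1 * g4\<close> is
  \<open>y + z\<close>. In the binomial expansion of its fifth power only \<open>y ^ 5\<close> and
  part of the next term are needed to absorb \<open>3 * X * y ^ 5\<close>.\<close>

lemma nonneg_first_factor:
  "nonneg_fps ((fps_geom 1 * fps_geom 4) ^ 5 - 3 * fps_X * (fps_geom 2 * fps_geom 3) ^ 5)"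
proof -
  define g1 g2 g3 g4 where "g1 = fps_geom 1" and "g2 = fps_geom 2" and "g3 = fps_geom 3" and "g4 = fps_geom 4"
  note g_def = g1_def g2_def g3_def g4_def
  define X where "X = (fps_X :: real fps)"
  define y z where "y = g2 * g3" and "z = X * g3 * g4"
  have g: "g1 * (1 - X) = 1" "g2 * (1 - X\<^sup>2) = 1" "g3 * (1 - X ^ 3) = 1" "g4 * (1 - X ^ 4) = 1"
    using fps_geom_mult[of 1] fps_geom_mult[of 2] fps_geom_mult[of 3] fps_geom_mult[of 4]
    by (simp_all add: g_def X_def)
  have x: "g1 * g4 = y + z"
    using geom_pair_diff[of 0] g(1,2) unfolding y_def z_def g_def X_def by simp algebra
  have g24: "g2 = g4 * (1 + X\<^sup>2)"
    using g(2,4) by algebra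
  \<comment> \<open>The polynomial arises from (1 + X^2)(1 - 3X) + 5X; the factors of
    \<open>y\<close> cancel its negative coefficient.\<close>
  have "(1 + 2 * X + X\<^sup>2 - 3 * X ^ 3) * y = 2 * X * g3 + g2 + X\<^sup>2 * y"
    using g(2,3) unfolding y_def by algebra
  hence key: "y * (y + 5 * z - 3 * X * y) = g3 * g4 * (2 * X * g3 + g2 + X\<^sup>2 * y)"
    unfolding z_def using g24 y_def by algebra
  have "(g1 * g4) ^ 5 - 3 * X * y ^ 5
      = y ^ 3 * (y * (y + 5 * z - 3 * X * y) + 10 * z\<^sup>2) + 10 * y\<^sup>2 * z ^ 3 + 5 * y * z ^ 4 + z ^ 5"
    unfolding x by algebra
  also have "nonneg_fps \<dots>"
    unfolding key unfolding y_def z_def g_def X_def by (intro nonneg_fps_intros nonneg_fps_geom)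
  finally show ?thesis by (simp add: y_def g_def X_def)
qed

text \<open>The difference splits as x0^5 (px^5 - py^5) + (x0^5 - 3 X y0^5) py^5. Length
  \<open>Suc N\<close> ensures that the factors with \<open>k = 0\<close> are present.\<close>

lemma nonneg_finite_products:
  fixes N :: nat
  defines "G \<equiv> fps_qinv 1 (Suc N) * fps_qinv 4 (Suc N)" and "H \<equiv> fps_qinv 2 (Suc N) * fps_qinv 3 (Suc N)"
  shows "nonneg_fps (G ^ 5 - 3 * fps_X * H ^ 5)"
proof -
  define x y where "x k = fps_geom (1 + 5 * k) * fps_geom (4 + 5 * k)"
    and "y k = fps_geom (2 + 5 * k) * fps_geom (3 + 5 * k)" for k
  define px py where "px = (\<Prod>k<N. x (Suc k))" and "py = (\<Prod>k<N. y (Suc k))"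
  have nn: "nonneg_fps (x k)" "nonneg_fps (y k)" for k
    unfolding x_def y_def by (intro nonneg_fps_intros nonneg_fps_geom)+
  have py: "nonneg_fps py"
    unfolding py_def by (intro nonneg_fps_prod nn)
  \<comment> \<open>The factor \<open>1 / (1 - q)\<^sup>2\<close> that makes the exchange of \<open>x k\<close> for \<open>y k\<close> monotone is borrowed from \<open>x 0 ^ 5\<close>.\<close>
  have G: "G = x 0 * px"
  proof -
    have "G = (\<Prod>k<Suc N. x k)"
      unfolding G_def fps_qinv_def x_def by (rule prod.distrib[symmetric])
    also have "\<dots> = x 0 * px"
      unfolding px_def by (rule prod.lessThan_Suc_shift)
    finally show ?thesis .
  qed
  have H: "H = y 0 * py"
  proof -
    have "H = (\<Prod>k<Suc N. y k)"
      unfolding H_def fps_qinv_def y_def by (rule prod.distrib[symmetric])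
    also have "\<dots> = y 0 * py"
      unfolding py_def by (rule prod.lessThan_Suc_shift)
    finally show ?thesis .
  qed
  have 1: "nonneg_fps (fps_geom 1 ^ 2 * (px ^ 5 - py ^ 5))"
    unfolding px_def py_def
    by (intro nonneg_fps_diff_power nonneg_fps_diff_prod nonneg_fps_prod nn)
       (unfold x_def y_def, rule nonneg_geom_pair_diff)
  have 2: "nonneg_fps (x 0 ^ 5 - 3 * fps_X * y 0 ^ 5)"
    using nonneg_first_factor by (simp add: x_def y_def)
  have "x 0 = fps_geom 1 * fps_geom 4"
    by (simp add: x_def)
  hence "G ^ 5 - 3 * fps_X * H ^ 5
      = (fps_geom 1 ^ 3 * fps_geom 4 ^ 5) * (fps_geom 1 ^ 2 * (px ^ 5 - py ^ 5))
        + (x 0 ^ 5 - 3 * fps_X * y 0 ^ 5) * py ^ 5"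
    unfolding G H by algebra
  also have "nonneg_fps \<dots>"
    by (rule nonneg_fps_add[OF nonneg_fps_mult[OF _ 1] nonneg_fps_mult[OF 2]])
       (intro nonneg_fps_intros nonneg_fps_geom py)+
  finally show ?thesis .
qed

section \<open>Transfer from truncated to infinite products\<close>

definition fps_agree :: "nat \<Rightarrow> real fps \<Rightarrow> real fps \<Rightarrow> bool" where
  "fps_agree n f g \<longleftrightarrow> (\<forall>i\<le>n. f $ i = g $ i)"

lemma fps_agree_mult: "fps_agree n f g \<Longrightarrow> fps_agree n f' g' \<Longrightarrow> fps_agree n (f * f') (g * g')"
  by (auto simp: fps_agree_def fps_mult_nth intro!: sum.cong)

lemma fps_agree_refl: "fps_agree n f f"
  by (simp add: fps_agree_def)

lemma fps_agree_power: "fps_agree n f g \<Longrightarrow> fps_agree n (f ^ k) (g ^ k)"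
  by (induction k) (auto intro: fps_agree_refl fps_agree_mult)

text \<open>Coefficient \<open>n\<close> depends on coefficients up to \<open>n\<close> only, where
  the infinite products agree with truncations of length \<open>Suc n\<close>.\<close>

lemma nonneg_G5_H5: "nonneg_fps (rr_coeff_G ^ 5 - 3 * fps_X * rr_coeff_H ^ 5)"
  unfolding nonneg_fps_def
proof
  fix n
  let ?G = "fps_qinv 1 (Suc n) * fps_qinv 4 (Suc n)" and ?H = "fps_qinv 2 (Suc n) * fps_qinv 3 (Suc n)"
  have a: "fps_agree n (fps_qinv_inf a) (fps_qinv a (Suc n))" if "a > 0" for a
    using that by (simp add: fps_agree_def fps_qinv_nth)
  have "fps_agree n (rr_coeff_G ^ 5) (?G ^ 5)" "fps_agree n (3 * fps_X * rr_coeff_H ^ 5) (3 * fps_X * ?H ^ 5)"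
    unfolding rr_coeff_G_def rr_coeff_H_def
    by (intro fps_agree_power fps_agree_mult fps_agree_refl a; simp)+
  hence "(rr_coeff_G ^ 5) $ n = (?G ^ 5) $ n" "(3 * fps_X * rr_coeff_H ^ 5) $ n = (3 * fps_X * ?H ^ 5) $ n"
    unfolding fps_agree_def by blast+
  hence "(rr_coeff_G ^ 5 - 3 * fps_X * rr_coeff_H ^ 5) $ n = (?G ^ 5 - 3 * fps_X * ?H ^ 5) $ n"
    by (simp only: fps_sub_nth)
  thus "(rr_coeff_G ^ 5 - 3 * fps_X * rr_coeff_H ^ 5) $ n \<ge> 0"
    using nonneg_finite_products[of n] by (simp add: nonneg_fps_def)
qed

section \<open>The 5-dissection of the fifth power\<close>

lemma fps_sums_to_has_fps_expansion:
  assumes "fps_sums_to f F"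
  shows "F has_fps_expansion Abs_fps (\<lambda>n. of_real (f $ n))"
proof (rule has_fps_expansionI)
  have "\<forall>\<^sub>F q in nhds 0. q \<in> ball (0 :: complex) 1"
    by (rule eventually_nhds_in_open) auto
  thus "\<forall>\<^sub>F q in nhds 0. (\<lambda>n. Abs_fps (\<lambda>n. of_real (f $ n)) $ n * q ^ n) sums F q"
    by eventually_elim (use fps_sums_toD[OF assms] in auto)
qed

lemma fps_sums_to_tendsto_0:
  assumes "fps_sums_to f F"
  shows "(F \<longlongrightarrow> of_real (f $ 0)) (at 0)"
proof -
  have "isCont F 0"
    using has_fps_expansion_imp_continuous[OF fps_sums_to_has_fps_expansion[OF assms], of UNIV] by simp
  moreover have "F 0 = of_real (f $ 0)"
    using fps_sums_toD[OF assms, of 0] powser_sums_zero[of "\<lambda>n. complex_of_real (f $ n)"]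
    by (simp add: sums_unique2)
  ultimately show ?thesis by (simp add: isCont_def)
qed

text \<open>R is the quotient H/G of two series with constant term 1. The limit later selects the
  root of the modular equation.\<close>

lemma rogers_ramanujan_R_tendsto_0: "(rogers_ramanujan_R \<longlongrightarrow> 1) (at 0)"
proof -
  have "((\<lambda>q. (1 / rr_den q) / (1 / rr_num q)) \<longlongrightarrow> 1 / 1) (at 0)"
    using fps_sums_to_tendsto_0[OF fps_sums_to_G] fps_sums_to_tendsto_0[OF fps_sums_to_H]
    by (intro tendsto_divide) (simp_all add: G_nth_0 H_nth_0)
  thus ?thesis by (simp add: rogers_ramanujan_R_eq[abs_def])
qed

text \<open>The coefficients of \<open>P\<^sup>2 (1 - v - v\<^sup>2)\<close>, where \<open>P = 1 - 2 v + 4 v\<^sup>2 - 3 v\<^sup>3 + v\<^sup>4\<close>.\<close>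

definition rr5_coeffs :: "real list" where
  "rr5_coeffs = [1, -5, 15, -30, 40, -36, 15, 5, -10, 5, -1]"

text \<open>The assumption \<open>nz\<close> excludes the second root of the modular equation,
  leaving U Q = v P. Multiplying by \<open>P * d\<close> puts d P Q in the denominator, which is a
  product in \<open>q ^ 5\<close>.\<close>

lemma rogers_ramanujan_R_power5:
  assumes "q \<noteq> 0" "norm q < 1"
  defines "v \<equiv> q * rogers_ramanujan_R (q ^ 5)"
  assumes nz: "q * rogers_ramanujan_R q ^ 5 * v * (1 - 2 * v + 4 * v ^ 2 - 3 * v ^ 3 + v ^ 4)
      + (1 + 3 * v + 4 * v ^ 2 + 2 * v ^ 3 + v ^ 4) \<noteq> 0"
  shows "rogers_ramanujan_R q ^ 5 = (\<Sum>i<11. of_real (rr5_coeffs ! i) *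
           (q ^ i * ((1 / rr_num (q ^ 5)) ^ (10 - i) * (1 / rr_den (q ^ 5)) ^ (2 + i))))"
proof -
  define U where "U = q * rogers_ramanujan_R q ^ 5"
  define P Q where "P = 1 - 2 * v + 4 * v ^ 2 - 3 * v ^ 3 + v ^ 4"
      and "Q = 1 + 3 * v + 4 * v ^ 2 + 2 * v ^ 3 + v ^ 4"
  define d where "d = 1 - v - v\<^sup>2"
  define a c where "a = rr_num (q ^ 5)" and "c = rr_den (q ^ 5)"
  define e where "e = qpochhammer_inf (q ^ 25) (q ^ 25)"
  have pw: "norm (q ^ k) < 1" if "k > 0" for k
    using assms(2) that by (rule norm_power_less_one)
  have nz': "a \<noteq> 0" "c \<noteq> 0" "e \<noteq> 0"
    unfolding a_def c_def e_def
    using rr_num_nonzero rr_den_nonzero pw[of 5] pw[of 25] qpochhammer_inf_nonzero by auto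
  have S: "rogers_ramanujan_R (q ^ 5) = a / c"
    by (simp add: rogers_ramanujan_R_eq a_def c_def)
  have "(U * Q - v * P) * (U * v * P + Q) = 0"
    unfolding U_def v_def P_def Q_def by (rule rogers_ramanujan_modular_equation[OF assms(1,2)])
  hence UQ: "U * Q = v * P"
    using nz unfolding U_def P_def Q_def by simp
  have fac: "1 - 11 * v ^ 5 - v ^ 10 = d * (P * Q)"
    unfolding P_def Q_def d_def by algebra
  have "(a * c * e) ^ 6 * (a / c) ^ 5 = e ^ 6 * (1 - 11 * v ^ 5 - v ^ 10)"
    using euler_sixth_power[OF assms(1,2)] euler_eq_rr_num_den[OF pw[of 5]]
    unfolding a_def[symmetric] c_def[symmetric] S v_def
    by (simp add: e_def flip: power_mult)
  moreover have "(a * c * e) ^ 6 * (a / c) ^ 5 = e ^ 6 * (a ^ 11 * c)"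
    using nz' by (simp add: field_simps eval_nat_numeral)
  \<comment> \<open>The Euler product at \<open>q ^ 5\<close> is \<open>a * c * e\<close>, so
    \<open>e ^ 6\<close> cancels from \<open>euler_sixth_power\<close>.\<close>
  ultimately have dPQ: "d * (P * Q) = a ^ 11 * c"
    using nz' fac by simp
  have "U * (d * (P * Q)) = v * (P\<^sup>2 * d)"
    using UQ by algebra
  hence "(q * a) * (rogers_ramanujan_R q ^ 5 * (a ^ 10 * c\<^sup>2)) = (q * a) * (P\<^sup>2 * d)"
    unfolding dPQ U_def v_def S using nz' by (simp add: field_simps eval_nat_numeral)
  hence "rogers_ramanujan_R q ^ 5 * (a ^ 10 * c\<^sup>2) = P\<^sup>2 * d"
    using assms(1) nz' by simp
  hence "rogers_ramanujan_R q ^ 5 = (P\<^sup>2 * d) / (a ^ 10 * c\<^sup>2)"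
    using nz' by (simp add: field_simps)
  also have "P\<^sup>2 * d = 1 - 5 * v + 15 * v ^ 2 - 30 * v ^ 3 + 40 * v ^ 4 - 36 * v ^ 5 + 15 * v ^ 6
      + 5 * v ^ 7 - 10 * v ^ 8 + 5 * v ^ 9 - v ^ 10"
    unfolding P_def d_def by algebra
  also have "\<dots> = (\<Sum>i<11. of_real (rr5_coeffs ! i) * v ^ i)"
    by (simp add: rr5_coeffs_def numeral_eq_Suc lessThan_Suc)
  also have "\<dots> / (a ^ 10 * c\<^sup>2) = (\<Sum>i<11. of_real (rr5_coeffs ! i) * (q ^ i * ((1 / a) ^ (10 - i) * (1 / c) ^ (2 + i))))"
    unfolding sum_divide_distrib
  proof (intro sum.cong refl)
    fix i :: nat assume "i \<in> {..<11}"
    \<comment> \<open>As \<open>i\<close> is at most 10, the powers of \<open>a\<close> in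
      \<open>v ^ i\<close> cancel completely and only reciprocals remain.\<close>
    hence "a ^ 10 = a ^ i * a ^ (10 - i)" by (simp flip: power_add)
    thus "of_real (rr5_coeffs ! i) * v ^ i / (a ^ 10 * c\<^sup>2)
        = of_real (rr5_coeffs ! i) * (q ^ i * ((1 / a) ^ (10 - i) * (1 / c) ^ (2 + i)))"
      using nz' unfolding v_def S
      by (simp add: power_mult_distrib power_divide power_add power2_eq_square field_simps)
  qed
  finally show ?thesis unfolding a_def c_def .
qed

text \<open>Each summand is a monomial times a series in X^5, so it meets a single residue class of
  exponents modulo 5.\<close>

definition rr5_fps :: "real fps" where
  "rr5_fps = (\<Sum>i<11. fps_const (rr5_coeffs ! i) *
     (fps_X ^ i * fps_stretch 5 (rr_coeff_G ^ (10 - i) * rr_coeff_H ^ (2 + i))))"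

lemma fps_stretch_shift_nth:
  assumes "r < 5"
  shows "(fps_X ^ i * fps_stretch 5 f) $ (5 * n + r) = (if i mod 5 = r then (fps_X ^ (i div 5) * f) $ n else 0)"
proof -
  define j where "j = i div 5"
  show ?thesis
  proof (cases "i mod 5 = r")
    case True
    hence i: "i = 5 * j + r"
      using mult_div_mod_eq[of 5 i] by (simp add: j_def)
    have "5 * n + r - i = 5 * (n - j)"
      unfolding i by (simp add: diff_mult_distrib2)
    moreover have "5 * n + r < i \<longleftrightarrow> n < j"
      unfolding i by simp
    ultimately show ?thesis
      using True by (simp add: fps_X_power_mult_nth fps_stretch_def flip: j_def)
  next
    case False
    have "\<not> 5 dvd (5 * n + r - i)" if "i \<le> 5 * n + r"
      using mod_eq_dvd_iff_nat[OF that, of 5] False assms by auto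
    thus ?thesis
      using False by (simp add: fps_X_power_mult_nth fps_stretch_def)
  qed
qed

text \<open>Among the indices below 11 only \<open>r\<close> and \<open>r + 5\<close> are congruent
  to \<open>r\<close> modulo 5. For residue 0 the index 10 would be a third one.\<close>

lemma rr5_fps_nth:
  assumes "0 < r" "r < 5"
  shows "rr5_fps $ (5 * n + r) = rr5_coeffs ! r * (rr_coeff_G ^ (10 - r) * rr_coeff_H ^ (2 + r)) $ n
    + rr5_coeffs ! (r + 5) * (fps_X * (rr_coeff_G ^ (5 - r) * rr_coeff_H ^ (7 + r))) $ n"
proof -
  define D where "D i = rr_coeff_G ^ (10 - i) * rr_coeff_H ^ (2 + i)" for i
  have "rr5_fps $ (5 * n + r) = (\<Sum>i<11. rr5_coeffs ! i *
     (if i mod 5 = r then (fps_X ^ (i div 5) * D i) $ n else 0))"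
    unfolding rr5_fps_def fps_sum_nth fps_mult_left_const_nth fps_stretch_shift_nth[OF assms(2)] D_def ..
  also have "\<dots> = (\<Sum>i\<in>{r, r + 5}. rr5_coeffs ! i * (fps_X ^ (i div 5) * D i) $ n)"
  proof (rule sum.mono_neutral_cong_right)
    show "\<forall>i\<in>{..<11} - {r, r + 5}. rr5_coeffs ! i * (if i mod 5 = r then (fps_X ^ (i div 5) * D i) $ n else 0) = 0"
    proof
      fix i :: nat assume i: "i \<in> {..<11} - {r, r + 5}"
      have "i mod 5 \<noteq> r"
      proof
        assume "i mod 5 = r"
        then obtain k where k: "i = 5 * k + r"
          by (metis mult_div_mod_eq)
        hence "5 * k + r < 11" "k \<noteq> 0" "k \<noteq> 1"
          using i by auto
        thus False using assms by linarith
      qed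
      thus "rr5_coeffs ! i * (if i mod 5 = r then (fps_X ^ (i div 5) * D i) $ n else 0) = 0"
        by simp
    qed
  qed (use assms in auto)
  also have "\<dots> = rr5_coeffs ! r * (fps_X ^ (r div 5) * D r) $ n
      + rr5_coeffs ! (r + 5) * (fps_X ^ ((r + 5) div 5) * D (r + 5)) $ n"
    by (subst sum.insert) auto
  also have "r div 5 = 0"
    using assms by simp
  also have "(r + 5) div 5 = 1"
    using assms by simp
  also have "D (r + 5) = rr_coeff_G ^ (5 - r) * rr_coeff_H ^ (7 + r)"
  proof -
    have "10 - (r + 5) = 5 - r" "2 + (r + 5) = 7 + r" by simp_all
    thus ?thesis by (simp only: D_def)
  qed
  finally show ?thesis
    by (simp only: D_def power_0 power_one_right mult_1)
qed

text \<open>A power series is determined by the germ at 0, so it suffices to have the closed form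
  near 0, where the correct root can be identified.\<close>

lemma rogers_ramanujan_R_power5_has_fps_expansion:
  "(\<lambda>q. rogers_ramanujan_R q ^ 5) has_fps_expansion Abs_fps (\<lambda>n. of_real (rr5_fps $ n))"
proof -
  let ?W = "\<lambda>q. \<Sum>i<11. of_real (rr5_coeffs ! i) *
           (q ^ i * ((1 / rr_num (q ^ 5)) ^ (10 - i) * (1 / rr_den (q ^ 5)) ^ (2 + i)))"
  have "fps_sums_to rr5_fps ?W"
    unfolding rr5_fps_def
    by (intro fps_sums_to_sum fps_sums_to_mult fps_sums_to_const fps_sums_to_power fps_sums_to_X
          fps_sums_to_stretch[where F = "\<lambda>q. (1 / rr_num q) ^ a * (1 / rr_den q) ^ b" for a b]
          fps_sums_to_G fps_sums_to_H) simp
  hence W: "?W has_fps_expansion Abs_fps (\<lambda>n. of_real (rr5_fps $ n))"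
    by (rule fps_sums_to_has_fps_expansion)
  let ?R = rogers_ramanujan_R
  let ?v = "\<lambda>q. q * ?R (q ^ 5)"
  have q5: "filterlim (\<lambda>q :: complex. q ^ 5) (at 0) (at 0)"
  proof (rule filterlim_atI)
    show "((\<lambda>q :: complex. q ^ 5) \<longlongrightarrow> 0) (at 0)"
      by (auto intro!: tendsto_eq_intros)
    show "\<forall>\<^sub>F q :: complex in at 0. q ^ 5 \<noteq> 0"
      by (simp add: eventually_at_filter)
  qed
  have v: "(?v \<longlongrightarrow> 0 * 1) (at 0)"
    by (intro tendsto_mult tendsto_ident_at filterlim_compose[OF rogers_ramanujan_R_tendsto_0 q5])
  \<comment> \<open>The limit is 1, so the second factor of the modular equation is nonzero near
    0.\<close>
  have "((\<lambda>q. q * ?R q ^ 5 * ?v q * (1 - 2 * ?v q + 4 * ?v q ^ 2 - 3 * ?v q ^ 3 + ?v q ^ 4)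
      + (1 + 3 * ?v q + 4 * ?v q ^ 2 + 2 * ?v q ^ 3 + ?v q ^ 4)) \<longlongrightarrow>
      0 * 1 ^ 5 * 0 * (1 - 2 * 0 + 4 * 0 ^ 2 - 3 * 0 ^ 3 + 0 ^ 4) + (1 + 3 * 0 + 4 * 0 ^ 2 + 2 * 0 ^ 3 + 0 ^ 4)) (at 0)"
    using v by (intro tendsto_intros rogers_ramanujan_R_tendsto_0) simp_all
  hence "\<forall>\<^sub>F q in at 0. q * ?R q ^ 5 * ?v q * (1 - 2 * ?v q + 4 * ?v q ^ 2 - 3 * ?v q ^ 3 + ?v q ^ 4)
      + (1 + 3 * ?v q + 4 * ?v q ^ 2 + 2 * ?v q ^ 3 + ?v q ^ 4) \<noteq> 0"
    by (rule tendsto_imp_eventually_ne) simp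
  moreover have "\<forall>\<^sub>F q in at 0. q \<in> ball (0 :: complex) 1 - {0}"
    by (rule eventually_at_in_open) auto
  ultimately have "\<forall>\<^sub>F q in at 0. ?R q ^ 5 = ?W q"
  proof eventually_elim
    case (elim q)
    show ?case
      by (rule rogers_ramanujan_R_power5) (use elim in auto)
  qed
  \<comment> \<open>The point 0 is checked separately, since the closed form was derived for
    \<open>q \<noteq> 0\<close>.\<close>
  moreover have "?R 0 ^ 5 = ?W 0"
  proof -
    have "qpochhammer_inf 0 0 = 1"
      by (simp add: qpochhammer_inf_def)
    hence "rr_num 0 = 1" "rr_den 0 = 1"
      by (simp_all add: rr_num_def rr_den_def)
    thus ?thesis
      by (simp add: rogers_ramanujan_R_eq rr5_coeffs_def numeral_eq_Suc lessThan_Suc)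
  qed
  ultimately have "\<forall>\<^sub>F q in nhds 0. ?R q ^ 5 = ?W q"
    by (simp add: eventually_nhds_conv_at)
  moreover have "\<forall>\<^sub>F q in nhds 0. eval_fps (Abs_fps (\<lambda>n. of_real (rr5_fps $ n))) q = ?W q"
    using W by (simp add: has_fps_expansion_def)
  ultimately have "\<forall>\<^sub>F q in nhds 0. eval_fps (Abs_fps (\<lambda>n. of_real (rr5_fps $ n))) q = ?R q ^ 5"
    by eventually_elim simp
  thus ?thesis
    using W by (simp add: has_fps_expansion_def)
qed

section \<open>Signs of the coefficients in the four residue classes\<close>

theorem theorem1p3:
  fixes B :: "nat \<Rightarrow> int"
  assumes "\<And>q :: complex. norm q < 1 \<Longrightarrow>
    (\<lambda>n. of_int (B n) * q ^ n) sums (rogers_ramanujan_R q ^ 5)"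
  shows "\<forall>n. B (5 * n + 1) < 0 \<and> B (5 * n + 2) > 0 \<and> B (5 * n + 3) < 0 \<and> B (5 * n + 4) > 0"
proof
  fix n
  let ?G = rr_coeff_G and ?H = rr_coeff_H
  have "(\<lambda>q. rogers_ramanujan_R q ^ 5) has_fps_expansion Abs_fps (\<lambda>n. of_int (B n))"
  proof (rule has_fps_expansionI)
    have "\<forall>\<^sub>F q in nhds 0. q \<in> ball (0 :: complex) 1"
      by (rule eventually_nhds_in_open) auto
    thus "\<forall>\<^sub>F q in nhds 0. (\<lambda>n. Abs_fps (\<lambda>n. of_int (B n)) $ n * q ^ n) sums rogers_ramanujan_R q ^ 5"
      by eventually_elim (use assms in auto)
  qed
  \<comment> \<open>Two power series expansions of the same function at 0 coincide.\<close>
  hence B: "of_int (B n) = rr5_fps $ n" for n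
    using fps_nth_fps_expansion[of _ _ n] rogers_ramanujan_R_power5_has_fps_expansion
    by (metis fps_nth_Abs_fps of_real_eq_iff of_real_of_int_eq)
  have c: "rr5_coeffs ! 1 = -5" "rr5_coeffs ! 2 = 15" "rr5_coeffs ! 3 = -30" "rr5_coeffs ! 4 = 40"
    "rr5_coeffs ! 6 = 15" "rr5_coeffs ! 7 = 5" "rr5_coeffs ! 8 = -10" "rr5_coeffs ! 9 = 5"
    by (simp_all add: rr5_coeffs_def)
  have nn: "nonneg_fps (?G ^ a * ?H ^ b)" for a b
    by (intro nonneg_fps_mult nonneg_fps_power nonneg_G nonneg_H)
  have nth0: "(?G ^ a * ?H ^ b) $ 0 = 1" for a b
    by (simp add: G_nth_0 H_nth_0 fps_power_zeroth)
  have pos: "0 < (?G ^ a * ?H ^ b) $ n" if a0: "a > 0" for a b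
  proof -
    obtain k where a: "a = Suc k"
      using a0 by (cases a) auto
    have "0 < (?G * (?G ^ k * ?H ^ b)) $ n"
      by (rule G_mult_pos) (simp_all only: nn nth0 zero_less_one)
    thus ?thesis by (simp only: a power_Suc mult.assoc)
  qed
  have nonneg: "0 \<le> (fps_X * (?G ^ a * ?H ^ b)) $ n" for a b
    using nonneg_fps_mult[OF nonneg_fps_X nn] unfolding nonneg_fps_def by blast
  have "rr5_fps $ (5 * n + 1) = (fps_const (-5) * (?G ^ 9 * ?H ^ 3) + fps_const 15 * (fps_X * (?G ^ 4 * ?H ^ 8))) $ n"
    unfolding fps_add_nth fps_mult_left_const_nth using rr5_fps_nth[of 1 n] c by simp
  \<comment> \<open>The two coefficients have opposite signs here; taking out \<open>?G\<close> and
    \<open>?G ^ 3 * ?H ^ 3\<close> leaves the series of \<open>nonneg_G5_H5\<close>.\<close>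
  also have "fps_const (-5) * (?G ^ 9 * ?H ^ 3) + fps_const 15 * (fps_X * (?G ^ 4 * ?H ^ 8))
      = fps_const (-5) * (?G * (?G ^ 3 * ?H ^ 3 * (?G ^ 5 - 3 * fps_X * ?H ^ 5)))"
    unfolding numeral_fps_const[symmetric] neg_numeral_fps_const[symmetric] by algebra
  finally have 1: "rr5_fps $ (5 * n + 1) = -5 * (?G * (?G ^ 3 * ?H ^ 3 * (?G ^ 5 - 3 * fps_X * ?H ^ 5))) $ n"
    unfolding fps_mult_left_const_nth .
  \<comment> \<open>Strictness comes from the detached factor \<open>?G\<close>, as the cofactor has
    constant term 1.\<close>
  have "0 < (?G * (?G ^ 3 * ?H ^ 3 * (?G ^ 5 - 3 * fps_X * ?H ^ 5))) $ n"
  proof (rule G_mult_pos)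
    show "nonneg_fps (?G ^ 3 * ?H ^ 3 * (?G ^ 5 - 3 * fps_X * ?H ^ 5))"
      by (intro nonneg_fps_mult[OF nn] nonneg_G5_H5)
    show "0 < (?G ^ 3 * ?H ^ 3 * (?G ^ 5 - 3 * fps_X * ?H ^ 5)) $ 0"
      by (simp add: G_nth_0 H_nth_0 fps_power_zeroth)
  qed
  with 1 B[of "5 * n + 1"] have "real_of_int (B (5 * n + 1)) < 0" by simp
  hence "B (5 * n + 1) < 0" by simp
  \<comment> \<open>In this class and the next two both coefficients have the same sign; the first
    summand is strictly signed and the second is at worst 0.\<close>
  moreover have 2: "rr5_fps $ (5 * n + 2) = 15 * (?G ^ 8 * ?H ^ 4) $ n + 5 * (fps_X * (?G ^ 3 * ?H ^ 9)) $ n"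
    using rr5_fps_nth[of 2 n] c by simp
  have "real_of_int (B (5 * n + 2)) > 0"
    unfolding B 2 using pos[of 8 4, OF zero_less_numeral] nonneg[of 3 9] by linarith
  hence "B (5 * n + 2) > 0" by simp
  moreover have 3: "rr5_fps $ (5 * n + 3) = -30 * (?G ^ 7 * ?H ^ 5) $ n - 10 * (fps_X * (?G ^ 2 * ?H ^ 10)) $ n"
    using rr5_fps_nth[of 3 n] c by simp
  have "real_of_int (B (5 * n + 3)) < 0"
    unfolding B 3 using pos[of 7 5, OF zero_less_numeral] nonneg[of 2 10] by linarith
  hence "B (5 * n + 3) < 0" by simp
  moreover have 4: "rr5_fps $ (5 * n + 4) = 40 * (?G ^ 6 * ?H ^ 6) $ n + 5 * (fps_X * (?G * ?H ^ 11)) $ n"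
    using rr5_fps_nth[of 4 n] c by simp
  have "real_of_int (B (5 * n + 4)) > 0"
    unfolding B 4 using pos[of 6 6, OF zero_less_numeral] nonneg[of 1 11, unfolded power_one_right] by linarith
  hence "B (5 * n + 4) > 0" by simp
  ultimately show "B (5 * n + 1) < 0 \<and> B (5 * n + 2) > 0 \<and> B (5 * n + 3) < 0 \<and> B (5 * n + 4) > 0"
    by blast
qed

end
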